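(* Assume $\rho>\mu-\lambda+\sqrt{\sigma^2+\lambda^2}$, and that $$\rho\le\mu+\sigma\quad\text{and}\quad\mu-\sigma<0.$$ Then $u_+=+\infty$, $$u_-=a\left[\frac{1-\frac{\lambda}{\lambda+\rho}\,\omega_-}{1-b\,\omega_-}\right],$$ and, with $$C_-=\frac{u_--a}{\omega_-u_-^{\Omega_-}},$$ the value function is given by $$g(y,-1)=\begin{cases}C_-\omega_-y^{\Omega_-},&0\le y\le u_-,\\ y-a,&y\ge u_-,\end{cases}\qquad g(y,+1)=\begin{cases}C_-y^{\Omega_-},&0\le y\le u_-,\\ by-a\frac{\lambda}{\lambda+\rho},&y\ge u_-.\end{cases}$$ (That is, in the general representation of $g$ given in the context, $C_+=C=0$.)
   Context: Fix real parameters $\lambda>0$, $\mu>0$, $\sigma>0$, $a>0$, $\rho>0$. Let $(\xi(t),t\ge 0)$ be the continuous-time Markov chain with (right-continuous) piecewise constant paths in $S=\{-1,+1\}$, which jumps from each state to the other at rate $\lambda$ (infinitesimal generator $\begin{pmatrix}-\lambda&\lambda\\ \lambda&-\lambda\end{pmatrix}$). For $Y_0\ge 0$, let $Y_t=Y_0\exp\left(\mu t+\sigma\int_0^t\xi(u)\,du\right)$, i.e. $dY_t/dt=(\mu+\sigma\xi(t))Y_t$. Let $(\mathcal F_t)$ be the completed natural filtration of $(\xi(t))$. $P_{y,s}$ and $E_{y,s}$ denote probability and expectation given $Y_0=y$, $\xi(0)=s$. The reward process is $X_t=e^{-\rho t}(Y_t-a)$ for $0\le t<\infty$, and $X_{+\infty}=0$.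 The value function is $g(y,s)=\sup_\tau E_{y,s}(X_\tau)$, the supremum being over all $(\mathcal F_t)$-stopping times $\tau$ with values in $[0,\infty]$. For $s=\pm1$, the set $\{y\in\mathbb R_+=[0,\infty): g(y,s)=y-a\}$ is an interval $[u_s,+\infty)$, which defines $u_\pm:=u_{\pm 1}\in[0,+\infty]$ (with $u_s=+\infty$ if the set is empty). Constants: $b=\lambda(\lambda+\rho-\mu-\sigma)^{-1}$, $\Omega=(\lambda+\rho)(\mu+\sigma)^{-1}$, $$\Omega_\pm=\frac{(\lambda+\rho)\mu\pm\sqrt{\lambda^2\mu^2+\sigma^2(\rho^2+2\lambda\rho)}}{\mu^2-\sigma^2},\qquad \omega_\pm=1+\frac{\rho}{\lambda}-\frac{\mu+\sigma}{\lambda}\Omega_\pm.$$ General representation: there are constants $C_-,C_+,C$ such that $g(y,-1)=C_-\omega_-y^{\Omega_-}+C_+\omega_+y^{\Omega_+}$ and $g(y,+1)=C_-y^{\Omega_-}+C_+y^{\Omega_+}$ for $0\le y\le u_-$ (terms with $C_+=0$ being read as $0$), and $g(y,+1)=by-a\frac{\lambda}{\lambda+\rho}+Cy^{\Omega}$ for all finite $y$ with $u_-\le y\le u_+$. *)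

theory Defs
  imports "HOL-Probability.Probability"
begin

section \<open>Finite-state Markov chains in continuous time\<close>

definition transition_semigroup ::
  "'s set \<Rightarrow> ('s \<Rightarrow> 's \<Rightarrow> real) \<Rightarrow> (real \<Rightarrow> 's \<Rightarrow> 's \<Rightarrow> real) \<Rightarrow> bool" where
  "transition_semigroup S Q p \<longleftrightarrow>
     (\<forall>t\<ge>0. \<forall>i\<in>S. (\<forall>j\<in>S. 0 \<le> p t i j) \<and> (\<Sum>j\<in>S. p t i j) = 1) \<and>
     (\<forall>i\<in>S. \<forall>j\<in>S. p 0 i j = of_bool (i = j)) \<and>
     (\<forall>t\<ge>0. \<forall>h\<ge>0. \<forall>i\<in>S. \<forall>j\<in>S. p (t + h) i j = (\<Sum>k\<in>S. p t i k * p h k j)) \<and>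
     (\<forall>i\<in>S. \<forall>j\<in>S. ((\<lambda>t. p t i j) has_real_derivative Q i j) (at 0 within {0..}))"

definition step_path :: "(real \<Rightarrow> 's) \<Rightarrow> bool" where
  "step_path x \<longleftrightarrow> (\<exists>T :: nat \<Rightarrow> real. T 0 = 0 \<and> strict_mono T \<and> filterlim T at_top sequentially \<and>
     (\<forall>n. \<forall>t\<in>{T n..<T (Suc n)}. x t = x (T n)))"

text \<open>Time runs through \<open>[0, \<infinity>]\<close>, rendered as \<^typ>\<open>ennreal\<close>, so that the library's
  \<^const>\<open>stopping_time\<close> for this filtration covers times taking the value \<open>\<infinity>\<close>.
  The process itself is indexed by \<^typ>\<open>real\<close> and used only at nonnegative times.\<close>

definition natural_events :: "'a measure \<Rightarrow> (real \<Rightarrow> 'a \<Rightarrow> real) \<Rightarrow> ennreal \<Rightarrow> 'a set set" where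
  "natural_events M \<xi> t =
     {\<xi> u -` B \<inter> space M | u B. 0 \<le> u \<and> ennreal u \<le> t \<and> B \<in> sets borel}"

definition natural_filtration ::
  "'a measure \<Rightarrow> (real \<Rightarrow> 'a \<Rightarrow> real) \<Rightarrow> ennreal \<Rightarrow> 'a measure" where
  "natural_filtration M \<xi> t = sigma (space M) (natural_events M \<xi> t)"

definition completed_natural_filtration ::
  "'a measure \<Rightarrow> (real \<Rightarrow> 'a \<Rightarrow> real) \<Rightarrow> ennreal \<Rightarrow> 'a measure" where
  "completed_natural_filtration M \<xi> t =
     sigma (space M) (natural_events M \<xi> t \<union> null_sets (completion M))"

definition markov_chain_from ::
  "'a measure \<Rightarrow> real set \<Rightarrow> (real \<Rightarrow> real \<Rightarrow> real) \<Rightarrow> (real \<Rightarrow> 'a \<Rightarrow> real) \<Rightarrow> real \<Rightarrow> bool" where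
  "markov_chain_from M S Q \<xi> s \<longleftrightarrow>
     prob_space M \<and>
     (\<forall>t\<ge>0. \<xi> t \<in> borel_measurable M) \<and>
     (\<forall>w\<in>space M. (\<forall>t\<ge>0. \<xi> t w \<in> S) \<and> step_path (\<lambda>t. \<xi> t w)) \<and>
     (AE w in M. \<xi> 0 w = s) \<and>
     (\<exists>p. transition_semigroup S Q p \<and>
        (\<forall>t\<ge>0. \<forall>h\<ge>0. \<forall>j\<in>S. AE w in M.
           real_cond_exp M (natural_filtration M \<xi> (ennreal t))
             (indicat_real {v \<in> space M. \<xi> (t + h) v = j}) w = p h (\<xi> t w) j))"

definition flip_generator :: "real \<Rightarrow> real \<Rightarrow> real \<Rightarrow> real" where
  "flip_generator lam i j = (if i = j then - lam else lam)"


section \<open>The stopping problem\<close>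

definition price :: "real \<Rightarrow> real \<Rightarrow> (real \<Rightarrow> 'a \<Rightarrow> real) \<Rightarrow> real \<Rightarrow> real \<Rightarrow> 'a \<Rightarrow> real" where
  "price mu sig \<xi> y t w = y * exp (mu * t + sig * integral {0..t} (\<lambda>u. \<xi> u w))"

definition reward ::
  "real \<Rightarrow> real \<Rightarrow> real \<Rightarrow> real \<Rightarrow> (real \<Rightarrow> 'a \<Rightarrow> real) \<Rightarrow> real \<Rightarrow> ennreal \<Rightarrow> 'a \<Rightarrow> real" where
  "reward mu sig a rho \<xi> y t w =
     (if t = \<infinity> then 0
      else exp (- rho * enn2real t) * (price mu sig \<xi> y (enn2real t) w - a))"

text \<open>The reward is bounded below by \<open>- a\<close>, so its expectation always makes sense in
  \<open>(- \<infinity>, \<infinity>]\<close>. The Bochner integral would return \<open>0\<close> when this expectation is infinite.\<close>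

definition extended_expectation :: "'a measure \<Rightarrow> ('a \<Rightarrow> real) \<Rightarrow> ereal" where
  "extended_expectation M X =
     enn2ereal (\<integral>\<^sup>+ w. ennreal (X w) \<partial>M) - enn2ereal (\<integral>\<^sup>+ w. ennreal (- X w) \<partial>M)"

text \<open>Here \<^term>\<open>P s\<close> is the law under which the chain starts from \<^term>\<open>s\<close>; the initial value
  of the price enters only as the factor \<^term>\<open>y\<close>. Stopping times of the completed filtration
  are measurable with respect to the completed measure only.\<close>

definition value_fun ::
  "real \<Rightarrow> real \<Rightarrow> real \<Rightarrow> real \<Rightarrow> (real \<Rightarrow> 'a measure) \<Rightarrow> (real \<Rightarrow> 'a \<Rightarrow> real) \<Rightarrow> real \<Rightarrow> real \<Rightarrow> ereal"
  where
  "value_fun mu sig a rho P \<xi> y s =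
     (SUP \<tau> \<in> {\<tau>. stopping_time (completed_natural_filtration (P s) \<xi>) \<tau>}.
        extended_expectation (completion (P s)) (\<lambda>w. reward mu sig a rho \<xi> y (\<tau> w) w))"

definition stopping_region :: "real \<Rightarrow> (real \<Rightarrow> real \<Rightarrow> ereal) \<Rightarrow> real \<Rightarrow> real set" where
  "stopping_region a g s = {y. 0 \<le> y \<and> g y s = ereal (y - a)}"

text \<open>The left endpoint of the stopping region; it is \<open>\<infinity>\<close> for the empty region.\<close>

definition threshold :: "real \<Rightarrow> (real \<Rightarrow> real \<Rightarrow> ereal) \<Rightarrow> real \<Rightarrow> ereal" where
  "threshold a g s = (INF y \<in> stopping_region a g s. ereal y)"

lemma threshold_eqI:
  assumes "0 \<le> u" and "stopping_region a g s = {y. u \<le> ereal y}"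
  shows "threshold a g s = u"
proof (cases u)
  case (real r)
  then show ?thesis
    unfolding threshold_def assms(2) by (intro INF_eqI) auto
next
  case PInf
  then show ?thesis
    by (simp add: threshold_def assms(2) top_ereal_def)
qed (use assms(1) in simp)

lemma threshold_eq_infinity_iff: "threshold a g s = \<infinity> \<longleftrightarrow> stopping_region a g s = {}"
  unfolding threshold_def top_ereal_def[symmetric] INF_top_conv by (auto simp: top_ereal_def)


section \<open>Constants\<close>

definition b_const :: "real \<Rightarrow> real \<Rightarrow> real \<Rightarrow> real \<Rightarrow> real" where
  "b_const lam mu sig rho = lam / (lam + rho - mu - sig)"

definition Omega_minus :: "real \<Rightarrow> real \<Rightarrow> real \<Rightarrow> real \<Rightarrow> real" where
  "Omega_minus lam mu sig rho =
     ((lam + rho) * mu - sqrt (lam\<^sup>2 * mu\<^sup>2 + sig\<^sup>2 * (rho\<^sup>2 + 2 * lam * rho))) / (mu\<^sup>2 - sig\<^sup>2)"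

definition omega_minus :: "real \<Rightarrow> real \<Rightarrow> real \<Rightarrow> real \<Rightarrow> real" where
  "omega_minus lam mu sig rho =
     1 + rho / lam - (mu + sig) / lam * Omega_minus lam mu sig rho"

end

theory Submission
  imports Defs
begin

text \<open>In the variable \<open>x = ln y\<close> the candidate value \<open>V\<close> is a positive profile that satisfies the
  first-order system \<open>c\<^sub>i V\<^sub>i' = (\<lambda> + \<rho>) V\<^sub>i - \<lambda> V\<^sub>-\<^sub>i\<close> with \<open>c\<^sub>i = \<mu> + \<sigma> i\<close> wherever it is optimal
  to continue, and the inequality \<open>\<le>\<close> everywhere. The semigroup is known only through its
  derivative at \<open>0\<close>, so the process is observed on a grid of mesh \<open>d\<close> and the log price is
  replaced by its Euler sum. The differential inequalities then give one-step inequalities with a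
  relative error \<open>\<epsilon> d\<close>, uniform in \<open>x\<close>, which is absorbed by changing the discount rate to
  \<open>\<rho> \<plusminus> \<epsilon>\<close>. Discrete optional stopping bounds the expectation of the stopped profile, and paths
  of the chain are step functions, so the Euler sums converge as \<open>d \<rightarrow> 0\<close>. Fatou's lemma yields
  \<open>E (e\<^sup>-\<^sup>\<rho>\<^sup>\<tau> (Y\<^sub>\<tau> - a)) \<le> V\<close> for every stopping time. Conversely, stopping at the first grid time
  with state \<open>-1\<close> and price at least \<open>u\<close> is nearly optimal: until then \<open>V\<close> loses nothing, and since
  \<open>\<rho> > \<mu> - \<lambda> + sqrt (\<sigma>\<^sup>2 + \<lambda>\<^sup>2)\<close>, the growth rate of the expected price, the contribution of late
  times is negligible.\<close>

section \<open>One-step estimates along the flow\<close>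

text \<open>Profiles grow exponentially in \<open>x\<close>, so a one-step error can be uniform only
  in relative terms. This is why they are required to be positive, with bounded logarithmic
  derivative and bounded ratio between the two states. The candidate reflects the signs of the
  speeds. In state -1 the price falls, so from below \<open>u\<close> it cannot reach
  \<open>u\<close> before a switch. In state +1 it grows at least at the discount rate, so waiting
  for a switch pays. Beyond \<open>u\<close> the +1 branch is therefore the expected payoff of
  stopping at the first switch; below \<open>u\<close> both branches follow one power of
  \<open>y\<close>. Continuity in both states fixes \<open>u\<close> and \<open>C\<close>. There is
  no smooth fit in state -1: the slope jumps upwards at \<open>u\<close>, and this jump yields the
  inequality in the stopping region. The two bounds differ in nature. Fatou rests on positivity and
  covers every stopping time, infinite values included. The lower bound passes to the limit by
  domination, hence its finite horizon and a second profile for the tail.\<close>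

lemma increment_le_off_finite:
  fixes G g :: "real \<Rightarrow> real"
  assumes "a \<le> b" and fin: "finite F" and cont: "continuous_on {a..b} G"
    and deriv: "\<And>x. x \<in> {a<..<b} - F \<Longrightarrow> (G has_real_derivative g x) (at x)"
    and bound: "\<And>x. x \<in> {a<..<b} - F \<Longrightarrow> g x \<le> B"
  shows "G b - G a \<le> B * (b - a)"
proof -
  \<comment> \<open>At exceptional points \<open>g'\<close> takes the value \<open>B\<close>, so
    that the comparison with \<open>B\<close> holds on the whole closed interval. The exceptional
    point in later uses is the kink of a profile.\<close>
  define g' where "g' x = (if x \<in> {a<..<b} - F then g x else B)" for x
  have "(g' has_integral (G b - G a)) {a..b}"
  proof (rule fundamental_theorem_of_calculus_interior_strong[OF fin \<open>a \<le> b\<close> _ cont])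
    fix x assume "x \<in> {a<..<b} - F"
    then show "(G has_vector_derivative g' x) (at x)"
      using deriv by (simp add: g'_def has_real_derivative_iff_has_vector_derivative)
  qed
  moreover have "((\<lambda>_. B) has_integral B * (b - a)) {a..b}"
    using has_integral_const_real[of B a b] \<open>a \<le> b\<close> by (simp add: mult.commute)
  ultimately show ?thesis
    by (rule has_integral_le) (use bound in \<open>auto simp: g'_def\<close>)
qed

text \<open>Gronwall in both directions: \<open>f x * exp (- K * x)\<close> is nonincreasing and
  \<open>f x * exp (K * x)\<close> is nondecreasing, and continuity carries this across
  \<open>z\<close>.\<close>

lemma log_lipschitz_bound:
  fixes f f' :: "real \<Rightarrow> real"
  assumes cont: "continuous_on UNIV f"
    and deriv: "\<And>x. x \<noteq> z \<Longrightarrow> (f has_real_derivative f' x) (at x)"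
    and bound: "\<And>x. x \<noteq> z \<Longrightarrow> \<bar>f' x\<bar> \<le> K * f x"
  shows "f y \<le> exp (K * \<bar>y - x\<bar>) * f x"
proof (cases "x \<le> y")
  case True
  have "f y * exp (- K * y) - f x * exp (- K * x) \<le> 0 * (y - x)"
  proof (rule increment_le_off_finite[OF True, of "{z}" _ "\<lambda>t. (f' t - K * f t) * exp (- K * t)"])
    show "continuous_on {x..y} (\<lambda>a. f a * exp (- K * a))"
      by (intro continuous_intros continuous_on_subset[OF cont]) auto
  next
    fix t assume "t \<in> {x<..<y} - {z}"
    then show "((\<lambda>a. f a * exp (- K * a)) has_real_derivative (f' t - K * f t) * exp (- K * t)) (at t)"
      by (auto intro!: derivative_eq_intros deriv simp: algebra_simps)
  next
    fix t assume "t \<in> {x<..<y} - {z}"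
    then show "(f' t - K * f t) * exp (- K * t) \<le> 0"
      using bound[of t] by (auto intro!: mult_nonpos_nonneg)
  qed simp
  then have "f y * exp (- K * y) * exp (K * y) \<le> f x * exp (- K * x) * exp (K * y)"
    by simp
  then have "f y \<le> f x * (exp (- K * x) * exp (K * y))"
    by (simp add: mult.assoc flip: exp_add)
  also have "exp (- K * x) * exp (K * y) = exp (K * \<bar>y - x\<bar>)"
    using True by (simp add: algebra_simps flip: exp_add)
  finally show ?thesis by (simp add: mult.commute)
next
  case False
  then have yx: "y \<le> x" by simp
  have "- (f x * exp (K * x)) - - (f y * exp (K * y)) \<le> 0 * (x - y)"
  proof (rule increment_le_off_finite[OF yx, of "{z}" _ "\<lambda>t. - ((f' t + K * f t) * exp (K * t))"])
    show "continuous_on {y..x} (\<lambda>a. - (f a * exp (K * a)))"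
      by (intro continuous_intros continuous_on_subset[OF cont]) auto
  next
    fix t assume "t \<in> {y<..<x} - {z}"
    then show "((\<lambda>a. - (f a * exp (K * a))) has_real_derivative - ((f' t + K * f t) * exp (K * t))) (at t)"
      by (auto intro!: derivative_eq_intros deriv simp: algebra_simps)
  next
    fix t assume "t \<in> {y<..<x} - {z}"
    then show "- ((f' t + K * f t) * exp (K * t)) \<le> 0"
      using bound[of t] by auto
  qed simp
  then have "f y * exp (K * y) * exp (- K * y) \<le> f x * exp (K * x) * exp (- K * y)"
    by simp
  then have "f y \<le> f x * (exp (K * x) * exp (- K * y))"
    by (simp add: mult.assoc flip: exp_add)
  also have "exp (K * x) * exp (- K * y) = exp (K * \<bar>y - x\<bar>)"
    using False by (simp add: algebra_simps flip: exp_add)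
  finally show ?thesis by (simp add: mult.commute)
qed

lemma abs_diff_le_log_lipschitz:
  fixes f :: "real \<Rightarrow> real"
  assumes "\<And>x y. f y \<le> exp (K * \<bar>y - x\<bar>) * f x" "0 \<le> K" "0 < f x" "\<bar>y - x\<bar> \<le> e"
  shows "\<bar>f y - f x\<bar> \<le> (exp (K * e) - 1) * f x"
proof -
  define E where "E = exp (K * e)"
  have E: "exp (K * \<bar>y - x\<bar>) \<le> E" "exp (K * \<bar>x - y\<bar>) \<le> E"
    using assms(2,4) by (auto simp: E_def mult_left_mono)
  have E1: "1 \<le> E" using assms(2,4) by (auto simp: E_def intro!: mult_nonneg_nonneg)
  have "0 < exp (K * \<bar>x - y\<bar>) * f y"
    using assms(1)[of x y] assms(3) by linarith
  then have yp: "0 < f y" by (simp add: zero_less_mult_iff)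
  have 1: "f y \<le> E * f x" using assms(1)[of y x] mult_right_mono[OF E(1), of "f x"] assms(3)
    by linarith
  have 2: "f x \<le> E * f y" using assms(1)[of x y] mult_right_mono[OF E(2), of "f y"] yp
    by linarith
  \<comment> \<open>The bound with \<open>x\<close> and \<open>y\<close> exchanged gives
    \<open>(E - 1) * f y\<close>; this may be enlarged to \<open>(E - 1) * f x\<close> when
    \<open>f y < f x\<close>, and otherwise the left side is nonpositive.\<close>
  have "f x - f y \<le> (E - 1) * f x"
  proof (cases "f x \<le> f y")
    case True then show ?thesis
      using mult_nonneg_nonneg[of "E - 1" "f x"] E1 assms(3) by linarith
  next
    case False
    then have "(E - 1) * f y \<le> (E - 1) * f x" using E1 by (intro mult_left_mono) auto
    with 2 show ?thesis by (simp add: algebra_simps)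
  qed
  with 1 show ?thesis unfolding E_def[symmetric] by (simp add: algebra_simps abs_le_iff)
qed

text \<open>The function \<open>f\<close> belongs to the state in which the particle moves at speed \<open>c\<close> and \<open>h\<close> to the
  other one; \<open>U\<close> is a region that the flow does not leave. With \<open>sg = 1\<close> the differential
  inequality says that \<open>(f, h)\<close> is a supersolution at rate \<open>r\<close>, with \<open>sg = -1\<close> a subsolution.\<close>

lemma one_step_estimate:
  fixes f h f' q :: "real \<Rightarrow> real"
  assumes "c \<noteq> 0" "0 < lam" "0 \<le> K" "0 \<le> R" "0 < eps" and sg: "sg = 1 \<or> sg = -1"
    and cont: "continuous_on UNIV f"
    and deriv: "\<And>x. x \<noteq> z \<Longrightarrow> (f has_real_derivative f' x) (at x)"
    and f_lip: "\<And>x y. f y \<le> exp (K * \<bar>y - x\<bar>) * f x"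
    and h_lip: "\<And>x y. h y \<le> exp (K * \<bar>y - x\<bar>) * h x"
    and fpos: "\<And>x. 0 < f x" and hpos: "\<And>x. 0 < h x" and hf: "\<And>x. h x \<le> R * f x"
    and flow: "\<And>x t. x \<in> U \<Longrightarrow> 0 \<le> t \<Longrightarrow> x + c * t \<in> U"
    and gen: "\<And>x. x \<in> U \<Longrightarrow> x \<noteq> z \<Longrightarrow> sg * (c * f' x) \<le> sg * ((lam + r) * f x - lam * h x)"
    and q: "((\<lambda>d. q d / d) \<longlongrightarrow> lam) (at_right 0)"
  shows "\<forall>\<^sub>F d in at_right 0. \<forall>x\<in>U.
    sg * ((1 - q d) * f (x + c * d) + q d * h (x + c * d)) \<le> sg * (exp ((r + sg * eps) * d) * f x)"
proof -
  define E where "E d = exp (K * (\<bar>c\<bar> * d)) - 1" for d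
  \<comment> \<open>Relative error per unit of time: the first term comes from freezing
    \<open>f\<close> and \<open>h\<close> at \<open>x\<close> during the step, the second from
    replacing the switching probability \<open>q d\<close> by \<open>lam * d\<close>. Neither
    depends on \<open>x\<close>.\<close>
  define err where "err d = E d * (\<bar>lam + r\<bar> + lam * R + lam * (1 + R))
    + \<bar>q d / d - lam\<bar> * (1 + R) * (1 + E d)" for d
  have E0: "(E \<longlongrightarrow> 0) (at_right 0)"
    unfolding E_def by (auto intro!: tendsto_eq_intros)
  have "(err \<longlongrightarrow> 0 * (\<bar>lam + r\<bar> + lam * R + lam * (1 + R)) + \<bar>lam - lam\<bar> * (1 + R) * (1 + 0)) (at_right 0)"
    unfolding err_def by (intro tendsto_intros q E0)
  then have "(err \<longlongrightarrow> 0) (at_right 0)" by simp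
  then have ev1: "\<forall>\<^sub>F d in at_right 0. err d < eps / 2"
    using \<open>0 < eps\<close> by (intro order_tendstoD) auto
  \<comment> \<open>This serves \<open>sg = -1\<close>. For \<open>sg = 1\<close> the inequality
    \<open>1 + y \<le> exp y\<close> does the same work for every \<open>d\<close>; the reverse
    comparison needs small \<open>d\<close>.\<close>
  have ev2: "\<forall>\<^sub>F d in at_right 0. exp ((r - eps) * d) \<le> 1 + (r - eps/2) * d"
  proof -
    have "((\<lambda>d. exp ((r - eps) * d)) has_real_derivative (r - eps)) (at 0)"
      by (auto intro!: derivative_eq_intros)
    then have "((\<lambda>d. (exp ((r - eps) * d) - 1) / d) \<longlongrightarrow> r - eps) (at_right 0)"
      by (simp add: has_field_derivative_iff filterlim_at_split)
    then have "\<forall>\<^sub>F d in at_right 0. (exp ((r - eps) * d) - 1) / d < r - eps/2"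
      using \<open>0 < eps\<close> by (intro order_tendstoD) auto
    then show ?thesis
      using eventually_at_right_less[of "0::real"]
      by eventually_elim (auto simp: field_simps)
  qed
  show ?thesis
    using ev1 ev2 eventually_at_right_less[of "0::real"]
  proof eventually_elim
    case (elim d)
    then have d: "0 < d" by simp
    show ?case
    proof
      fix x assume x: "x \<in> U"
      have Epos: "0 \<le> E d" using d \<open>0 \<le> K\<close> by (auto simp: E_def)
      have fd: "\<bar>f (x + c * t) - f x\<bar> \<le> E d * f x"
        and hd: "\<bar>h (x + c * t) - h x\<bar> \<le> E d * h x" if "0 \<le> t" "t \<le> d" for t
        unfolding E_def
        by (rule abs_diff_le_log_lipschitz; use f_lip h_lip fpos hpos that \<open>0 \<le> K\<close> in
            \<open>auto simp: abs_mult mult_left_mono\<close>)+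
      have Eh: "E d * h x \<le> E d * (R * f x)"
        using Epos hf by (intro mult_left_mono)
      \<comment> \<open>\<open>B\<close> bounds the derivative of \<open>sg * f\<close> along the
        flow: the differential inequality frozen at \<open>x\<close>, plus the cost of
        freezing.\<close>
      define B where "B = sg * ((lam + r) * f x - lam * h x) + E d * (\<bar>lam + r\<bar> + lam * R) * f x"
      have "sg * f (x + c * d) - sg * f (x + c * 0) \<le> B * (d - 0)"
      \<comment> \<open>Since \<open>c\<close> is nonzero, the flow is at the kink \<open>z\<close>
        only at the time \<open>(z - x) / c\<close>.\<close>
      proof (rule increment_le_off_finite[of 0 d "{(z - x) / c}" _ "\<lambda>t. sg * (c * f' (x + c * t))"])
        show "continuous_on {0..d} (\<lambda>t. sg * f (x + c * t))"
          by (intro continuous_intros continuous_on_compose2[OF cont]) auto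
      next
        fix t assume t: "t \<in> {0<..<d} - {(z - x) / c}"
        then have ne: "x + c * t \<noteq> z" using \<open>c \<noteq> 0\<close> by (auto simp: field_simps)
        show "((\<lambda>t. sg * f (x + c * t)) has_real_derivative sg * (c * f' (x + c * t))) (at t)"
        proof -
          have "((\<lambda>t. x + c * t) has_real_derivative c) (at t)"
            by (auto intro!: derivative_eq_intros)
          from DERIV_cmult[OF DERIV_chain2[OF deriv[OF ne] this], of sg] show ?thesis
            by (simp add: mult.commute)
        qed
        have "sg * (c * f' (x + c * t)) \<le> sg * ((lam + r) * f (x + c * t) - lam * h (x + c * t))"
          using gen[OF flow[OF x] ne] t by auto
        also have "\<dots> = sg * ((lam + r) * f x - lam * h x)
          + (sg * (lam + r) * (f (x + c * t) - f x) + - (sg * lam * (h (x + c * t) - h x)))"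
          by (simp add: algebra_simps)
        also have "sg * (lam + r) * (f (x + c * t) - f x) \<le> \<bar>lam + r\<bar> * (E d * f x)"
        proof -
          have "sg * (lam + r) * (f (x + c * t) - f x) \<le> \<bar>sg * (lam + r) * (f (x + c * t) - f x)\<bar>"
            by simp
          also have "\<dots> \<le> \<bar>lam + r\<bar> * (E d * f x)"
            using fd[of t] t sg by (auto simp: abs_mult intro!: mult_left_mono)
          finally show ?thesis .
        qed
        also have "- (sg * lam * (h (x + c * t) - h x)) \<le> lam * (E d * (R * f x))"
        proof -
          have "- (sg * lam * (h (x + c * t) - h x)) \<le> \<bar>sg * lam * (h (x + c * t) - h x)\<bar>"
            by simp
          also have "\<dots> \<le> lam * (E d * (R * f x))"
            using hd[of t] Eh t sg \<open>0 < lam\<close> by (auto simp: abs_mult intro!: mult_left_mono)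
          finally show ?thesis .
        qed
        finally show "sg * (c * f' (x + c * t)) \<le> B"
          by (simp add: B_def algebra_simps)
      qed (use d in auto)
      then have 1: "sg * f (x + c * d) \<le> sg * f x + d * B"
        by (simp add: algebra_simps)
      define F H where "F = f (x + c * d)" and "H = h (x + c * d)"
      have FH: "\<bar>F - f x\<bar> \<le> E d * f x" "\<bar>H - h x\<bar> \<le> E d * (R * f x)"
        using fd[of d] hd[of d] Eh d by (auto simp: F_def H_def)
      have FHpos: "0 < F" "0 < H" using fpos hpos by (auto simp: F_def H_def)
      define w where "w = q d / d - lam"
      have qd: "q d = d * lam + d * w" using d by (simp add: w_def field_simps)
      have 2: "sg * (q d * (H - F)) \<le> lam * d * (sg * (h x - f x)) + lam * d * (E d * (1 + R) * f x)
        + d * (\<bar>w\<bar> * ((1 + R) * (1 + E d) * f x))"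
      proof -
        have "sg * (q d * (H - F)) = lam * d * (sg * (h x - f x)) + lam * d * (sg * ((H - h x) - (F - f x)))
          + d * (sg * w * (H - F))"
          by (subst qd) (simp add: algebra_simps)
        moreover have "lam * d * (sg * ((H - h x) - (F - f x))) \<le> lam * d * (E d * (1 + R) * f x)"
        proof (intro mult_left_mono)
          have "sg * ((H - h x) - (F - f x)) \<le> \<bar>H - h x\<bar> + \<bar>F - f x\<bar>"
            using sg by auto
          also have "\<dots> \<le> E d * (1 + R) * f x"
            using FH by (simp add: algebra_simps)
          finally show "sg * ((H - h x) - (F - f x)) \<le> E d * (1 + R) * f x" .
        qed (use \<open>0 < lam\<close> d in simp)
        moreover have "d * (sg * w * (H - F)) \<le> d * (\<bar>w\<bar> * ((1 + R) * (1 + E d) * f x))"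
        proof (intro mult_left_mono)
          have "\<bar>H - F\<bar> \<le> H + F" using FHpos by (simp add: abs_le_iff)
          also have "\<dots> \<le> (1 + R) * (1 + E d) * f x"
          proof -
            have "F \<le> (1 + E d) * f x" "H \<le> h x + E d * (R * f x)"
              using FH by (simp_all add: algebra_simps abs_le_iff)
            then show ?thesis using hf[of x] by (simp add: algebra_simps)
          qed
          finally have "\<bar>w\<bar> * \<bar>H - F\<bar> \<le> \<bar>w\<bar> * ((1 + R) * (1 + E d) * f x)"
            by (intro mult_left_mono) auto
          moreover have "sg * w * (H - F) \<le> \<bar>sg * w * (H - F)\<bar>" by simp
          moreover have "\<bar>sg * w * (H - F)\<bar> = \<bar>w\<bar> * \<bar>H - F\<bar>"
            using sg by (auto simp: abs_mult)
          ultimately show "sg * w * (H - F) \<le> \<bar>w\<bar> * ((1 + R) * (1 + E d) * f x)"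
            by linarith
        qed (use d in simp)
        ultimately show ?thesis by linarith
      qed
      have "sg * ((1 - q d) * F + q d * H) = sg * F + sg * (q d * (H - F))"
        by (simp add: algebra_simps)
      also have "\<dots> \<le> sg * f x + d * B + (lam * d * (sg * (h x - f x)) + lam * d * (E d * (1 + R) * f x)
        + d * (\<bar>w\<bar> * ((1 + R) * (1 + E d) * f x)))"
        using 1 2 by (simp add: F_def)
      also have "\<dots> = sg * f x + sg * (r * d * f x) + err d * (d * f x)"
        by (simp add: B_def err_def w_def algebra_simps)
      also have "err d * (d * f x) \<le> eps / 2 * (d * f x)"
        using elim d fpos[of x] by (intro mult_right_mono) auto
      finally have 3: "sg * ((1 - q d) * F + q d * H) \<le> sg * f x + sg * (r * d * f x) + eps / 2 * (d * f x)"
        by simp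
      \<comment> \<open>One half of \<open>eps\<close> has absorbed \<open>err\<close>; the other
        half pays for passing from the linear factor to the exponential.\<close>
      have "sg * f x + sg * (r * d * f x) + eps / 2 * (d * f x) = sg * ((1 + (r + sg * eps / 2) * d) * f x)"
        using sg by (auto simp: algebra_simps)
      also have "\<dots> \<le> sg * (exp ((r + sg * eps) * d) * f x)"
        using sg
      proof
        assume s: "sg = 1"
        have "1 + (r + eps / 2) * d \<le> 1 + (r + eps) * d" using d \<open>0 < eps\<close> by simp
        also have "\<dots> \<le> exp ((r + eps) * d)" by (rule exp_ge_add_one_self)
        finally show ?thesis using s fpos[of x] by (auto intro!: mult_right_mono)
      next
        assume s: "sg = -1"
        then show ?thesis using elim fpos[of x] by (auto intro!: mult_right_mono)
      qed
      finally show "sg * ((1 - q d) * f (x + c * d) + q d * h (x + c * d)) \<le> sg * (exp ((r + sg * eps) * d) * f x)"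
        using 3 by (simp add: F_def H_def)
    qed
  qed
qed


section \<open>Optional stopping and the Markov property on a grid\<close>

text \<open>The cap makes the index bounded on every path. The value \<open>n\<close> is returned
  both when \<open>Q\<close> first holds at \<open>n\<close> and when it never holds up to
  \<open>n\<close>.\<close>

definition first_time :: "(nat \<Rightarrow> 'a \<Rightarrow> bool) \<Rightarrow> nat \<Rightarrow> 'a \<Rightarrow> nat" where
  "first_time Q n w = (LEAST k. Q k w \<or> k = n)"

lemma first_time_le: "first_time Q n w \<le> n"
  unfolding first_time_def by (rule Least_le) simp

lemma first_time_hit: "Q (first_time Q n w) w \<or> first_time Q n w = n"
  unfolding first_time_def by (rule LeastI[of _ n]) simp

lemma not_before_first_time: "k < first_time Q n w \<Longrightarrow> \<not> Q k w"
  unfolding first_time_def using not_less_Least by blast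

lemma first_time_eq_bound: "(\<And>i. i < n \<Longrightarrow> \<not> Q i w) \<Longrightarrow> first_time Q n w = n"
  using first_time_hit[of Q n w] first_time_le[of Q n w] le_neq_implies_less by metis

lemma first_time_Suc:
  "first_time Q (Suc n) w = (if \<forall>i\<le>n. \<not> Q i w then Suc n else first_time Q n w)"
proof (cases "\<forall>i\<le>n. \<not> Q i w")
  case True
  then show ?thesis by (auto intro!: first_time_eq_bound)
next
  case False
  then obtain i where i: "i \<le> n" "Q i w" by blast
  have *: "first_time Q m w = (LEAST k. Q k w)" if "i \<le> m" for m
  proof -
    have "(LEAST k. Q k w) \<le> m" using Least_le[of "\<lambda>k. Q k w", OF i(2)] that by simp
    then show ?thesis
      unfolding first_time_def
      by (intro Least_equality)
        (use LeastI[of "\<lambda>k. Q k w", OF i(2)] in \<open>auto intro: Least_le\<close>)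
  qed
  have "first_time Q (Suc n) w = first_time Q n w" using *[of n] *[of "Suc n"] i(1) by simp
  then show ?thesis using False by (simp only: if_False)
qed

text \<open>Raising the cap from \<open>n\<close> to \<open>Suc n\<close> adds exactly the increment
  of \<open>Z\<close> on the event that \<open>Q\<close> has failed up to \<open>n\<close>. The
  hypothesis \<open>step\<close> is this integrated form, so no conditional expectation with respect
  to the completed filtration appears.\<close>

lemma optional_stopping:
  fixes Z :: "nat \<Rightarrow> 'a \<Rightarrow> real"
  assumes int: "\<And>k. integrable M (Z k)"
    and meas: "\<And>k. {w \<in> space M. Q k w} \<in> sets M"
    and step: "\<And>k. (\<integral>w. indicator {w \<in> space M. \<forall>i\<le>k. \<not> Q i w} w * (Z (Suc k) w - Z k w) \<partial>M) \<le> 0"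
  shows "integrable M (\<lambda>w. Z (first_time Q n w) w) \<and> (\<integral>w. Z (first_time Q n w) w \<partial>M) \<le> (\<integral>w. Z 0 w \<partial>M)"
proof (induction n)
  case 0
  then show ?case using int first_time_le[of Q 0] by simp
next
  case (Suc n)
  have [measurable]: "Measurable.pred M (Q k)" for k
    using meas[of k] by (simp add: pred_def)
  let ?I = "indicator {w \<in> space M. \<forall>i\<le>n. \<not> Q i w} :: 'a \<Rightarrow> real"
  have eq: "Z (first_time Q (Suc n) w) w = Z (first_time Q n w) w + ?I w * (Z (Suc n) w - Z n w)"
    if "w \<in> space M" for w
    using that first_time_eq_bound[of n Q w] by (auto simp: first_time_Suc indicator_def)
  have intI: "integrable M (\<lambda>w. ?I w * (Z (Suc n) w - Z n w))"
    using int by (intro integrable_mult_indicator[where 'a='a and 'b=real, unfolded real_scaleR_def]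
      Bochner_Integration.integrable_diff) auto
  have "integrable M (\<lambda>w. Z (first_time Q (Suc n) w) w)
    \<longleftrightarrow> integrable M (\<lambda>w. Z (first_time Q n w) w + ?I w * (Z (Suc n) w - Z n w))"
    using eq by (intro Bochner_Integration.integrable_cong) auto
  moreover have "(\<integral>w. Z (first_time Q (Suc n) w) w \<partial>M)
    = (\<integral>w. Z (first_time Q n w) w + ?I w * (Z (Suc n) w - Z n w) \<partial>M)"
    using eq by (intro Bochner_Integration.integral_cong) auto
  moreover have "\<dots> = (\<integral>w. Z (first_time Q n w) w \<partial>M) + (\<integral>w. ?I w * (Z (Suc n) w - Z n w) \<partial>M)"
    using Suc intI by (intro Bochner_Integration.integral_add) auto
  ultimately show ?case using Suc intI step[of n] by auto
qed

text \<open>The velocity of the log price is a telegraph process whose two speeds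
  \<open>mu + sig\<close> and \<open>mu - sig\<close> have opposite signs. A transition function
  \<open>p\<close> is fixed because the chain assumption only asserts that one exists.\<close>

locale telegraph = prob_space M for M :: "'a measure" +
  fixes \<xi> :: "real \<Rightarrow> 'a \<Rightarrow> real" and p :: "real \<Rightarrow> real \<Rightarrow> real \<Rightarrow> real"
    and lam mu sig s :: real
  assumes lam_pos: "0 < lam" and mu_pos: "0 < mu" and mu_less_sig: "mu < sig"
    and start: "s \<in> {-1, 1}" "AE w in M. \<xi> 0 w = s"
    and measurable_state [measurable]: "\<And>t. 0 \<le> t \<Longrightarrow> \<xi> t \<in> borel_measurable M"
    and state: "\<And>t w. w \<in> space M \<Longrightarrow> 0 \<le> t \<Longrightarrow> \<xi> t w \<in> {-1, 1}"
    and step_path: "\<And>w. w \<in> space M \<Longrightarrow> step_path (\<lambda>t. \<xi> t w)"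
    and semigroup: "transition_semigroup {-1, 1} (flip_generator lam) p"
    and markov: "\<And>t h j. 0 \<le> t \<Longrightarrow> 0 \<le> h \<Longrightarrow> j \<in> {-1, 1} \<Longrightarrow> AE w in M.
           real_cond_exp M (natural_filtration M \<xi> (ennreal t))
             (indicat_real {v \<in> space M. \<xi> (t + h) v = j}) w = p h (\<xi> t w) j"
begin

section \<open>Natural and completed filtrations, and the Markov property in integrated form\<close>

abbreviation natural :: "real \<Rightarrow> 'a measure" where
  "natural t \<equiv> natural_filtration M \<xi> (ennreal t)"

abbreviation completed :: "real \<Rightarrow> 'a measure" where
  "completed t \<equiv> completed_natural_filtration M \<xi> (ennreal t)"

lemma space_natural [simp]: "space (natural_filtration M \<xi> t) = space M"
  by (auto simp: natural_filtration_def natural_events_def space_measure_of_conv)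

lemma space_completed [simp]: "space (completed_natural_filtration M \<xi> t) = space M"
  by (simp add: completed_natural_filtration_def space_measure_of_conv)

lemma sets_natural: "sets (natural_filtration M \<xi> t) = sigma_sets (space M) (natural_events M \<xi> t)"
  unfolding natural_filtration_def by (intro sets_measure_of) (auto simp: natural_events_def)

lemma sets_completed: "sets (completed_natural_filtration M \<xi> t)
    = sigma_sets (space M) (natural_events M \<xi> t \<union> null_sets (completion M))"
  unfolding completed_natural_filtration_def
  by (intro sets_measure_of)
    (use sets.sets_into_space[of _ "completion M"] in \<open>auto simp: natural_events_def null_sets_def\<close>)

lemma natural_events_sets: "natural_events M \<xi> t \<subseteq> sets M"
  by (auto simp: natural_events_def intro!: measurable_sets[OF measurable_state])

lemma subalgebra_natural: "subalgebra M (natural_filtration M \<xi> t)"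
  unfolding subalgebra_def sets_natural
  using sets.sigma_sets_subset[OF natural_events_sets] by simp

lemma completed_subset_completion:
  "sets (completed_natural_filtration M \<xi> t) \<subseteq> sets (completion M)"
  unfolding sets_completed
  using sets.sigma_sets_subset[of "natural_events M \<xi> t \<union> null_sets (completion M)" "completion M"]
    natural_events_sets[of t] by auto

lemma natural_subset_completed:
  "sets (natural_filtration M \<xi> t) \<subseteq> sets (completed_natural_filtration M \<xi> t)"
  unfolding sets_natural sets_completed by (intro sigma_sets_mono') auto

lemma completed_mono:
  "t \<le> u \<Longrightarrow> sets (completed_natural_filtration M \<xi> t) \<subseteq> sets (completed_natural_filtration M \<xi> u)"
  unfolding sets_completed
  by (intro sigma_sets_mono' Un_mono) (auto simp: natural_events_def intro: order_trans)

text \<open>The Markov property is given for the natural filtration, while stopping times live on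
  the completed one; this transfers events between them. The sets that agree almost everywhere with
  a natural event form a sigma-algebra containing all generators.\<close>

lemma completed_ex_natural:
  assumes "A \<in> sets (completed_natural_filtration M \<xi> t)"
  shows "\<exists>B\<in>sets (natural_filtration M \<xi> t). AE w in M. w \<in> A \<longleftrightarrow> w \<in> B"
  using assms unfolding sets_completed
proof (induction rule: sigma_sets.induct)
  case (Basic A)
  then show ?case
  proof
    assume "A \<in> natural_events M \<xi> t"
    then show ?thesis by (intro bexI[of _ A]) (auto simp: sets_natural)
  next
    assume "A \<in> null_sets (completion M)"
    then have "AE w in M. w \<notin> A"
      using AE_not_in AE_completion_iff by blast
    then show ?thesis by (intro bexI[of _ "{}"]) auto
  qed
next
  case Empty
  then show ?case by (intro bexI[of _ "{}"]) auto
next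
  case (Compl A)
  then obtain B where B: "B \<in> sets (natural_filtration M \<xi> t)" "AE w in M. w \<in> A \<longleftrightarrow> w \<in> B"
    by blast
  show ?case
  proof (intro bexI[of _ "space M - B"])
    show "AE w in M. w \<in> space M - A \<longleftrightarrow> w \<in> space M - B"
      using B(2) by eventually_elim auto
    show "space M - B \<in> sets (natural_filtration M \<xi> t)"
      using sets.compl_sets[OF B(1)] by simp
  qed
next
  case (Union A)
  then have "\<forall>i. \<exists>B\<in>sets (natural_filtration M \<xi> t). AE w in M. w \<in> A i \<longleftrightarrow> w \<in> B" by blast
  then obtain B where B: "\<And>i::nat. B i \<in> sets (natural_filtration M \<xi> t)"
      "\<And>i. AE w in M. w \<in> A i \<longleftrightarrow> w \<in> B i" by metis
  have "AE w in M. \<forall>i. w \<in> A i \<longleftrightarrow> w \<in> B i" using B(2) by (simp add: AE_all_countable)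
  then have "AE w in M. w \<in> (\<Union>i. A i) \<longleftrightarrow> w \<in> (\<Union>i. B i)" by eventually_elim auto
  then show ?case using B(1) by (intro bexI[of _ "\<Union>i. B i"]) auto
qed

lemma measurable_natural: "0 \<le> u \<Longrightarrow> u \<le> t \<Longrightarrow> \<xi> u \<in> borel_measurable (natural t)"
  by (rule measurableI) (auto simp: sets_natural natural_events_def intro!: sigma_sets.Basic ennreal_leI)

text \<open>\<open>F\<close> is only assumed measurable in its second argument. That suffices
  because the state takes two values, so the composition is a case distinction.\<close>

lemma measurable_state_fun:
  fixes F :: "real \<Rightarrow> real \<Rightarrow> real"
  assumes [measurable]: "\<xi> t \<in> borel_measurable N" "X \<in> borel_measurable N"
    and F: "F 1 \<in> borel_measurable borel" "F (-1) \<in> borel_measurable borel"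
    and "space N = space M" "0 \<le> t"
  shows "(\<lambda>w. F (\<xi> t w) (X w)) \<in> borel_measurable N"
proof -
  note [measurable] = F
  have "(\<lambda>w. if \<xi> t w = 1 then F 1 (X w) else F (-1) (X w)) \<in> borel_measurable N"
    by measurable
  also have "?this \<longleftrightarrow> ?thesis"
  proof (rule measurable_cong)
    fix w assume "w \<in> space N"
    then show "(if \<xi> t w = 1 then F 1 (X w) else F (-1) (X w)) = F (\<xi> t w) (X w)"
      using state[of w t] assms(5,6) by auto
  qed
  finally show ?thesis .
qed

sublocale completion: prob_space "completion M"
  using emeasure_space_1 by (intro prob_spaceI) simp

text \<open>\<open>A\<close> is replaced by an almost everywhere equal natural event, the integral
  moves from the completion to \<open>M\<close>, and there the conditional expectation is averaged
  against a bounded natural weight.\<close>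

lemma markov_step:
  assumes A: "A \<in> sets (completed t)" and t: "0 \<le> t" "0 \<le> h" and j: "j \<in> {-1, 1}"
    and g: "g \<in> borel_measurable (natural t)" and bound: "\<And>w. w \<in> space M \<Longrightarrow> \<bar>g w\<bar> \<le> K"
  shows "(\<integral>w. indicator A w * g w * indicator {v \<in> space M. \<xi> (t + h) v = j} w \<partial>completion M)
    = (\<integral>w. indicator A w * g w * p h (\<xi> t w) j \<partial>completion M)"
proof -
  interpret F: finite_measure_subalgebra M "natural t"
    by unfold_locales (rule subalgebra_natural)
  obtain B where B: "B \<in> sets (natural t)" "AE w in M. w \<in> A \<longleftrightarrow> w \<in> B"
    using completed_ex_natural[OF A] by blast
  have BM [measurable]: "B \<in> sets M" "g \<in> borel_measurable M"
    using B(1) subalgebra_natural[of t] measurable_from_subalg[OF subalgebra_natural g]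
    by (auto simp: subalgebra_def)
  have AM [measurable]: "A \<in> sets (completion M)"
    using A completed_subset_completion by blast
  have [measurable]: "\<xi> t \<in> borel_measurable M" "\<xi> (t + h) \<in> borel_measurable M"
    using t by (auto intro: measurable_state)
  have pm [measurable]: "(\<lambda>w. p h (\<xi> t w) j) \<in> borel_measurable M"
    by (rule measurable_state_fun[where F="\<lambda>i _. p h i j" and X="\<lambda>_. 0"]) (use t in auto)
  define J where "J = {v \<in> space M. \<xi> (t + h) v = j}"
  have [measurable]: "J \<in> sets M" unfolding J_def by measurable
  note [measurable] = measurable_completion[OF BM(2)] measurable_completion[OF pm]
    sets_completionI_sets[OF BM(1)] sets_completionI_sets[OF \<open>J \<in> sets M\<close>]
  have AE: "AE w in completion M. w \<in> A \<longleftrightarrow> w \<in> B"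
    using B(2) by (simp add: AE_completion_iff)
  have "(\<integral>w. indicator A w * g w * indicator J w \<partial>completion M)
      = (\<integral>w. indicator B w * g w * indicator J w \<partial>completion M)"
    using AE by (intro integral_cong_AE) (measurable, auto simp: indicator_def elim!: eventually_mono)
  also have "\<dots> = (\<integral>w. (indicator B w * g w) * indicator J w \<partial>M)"
    by (intro integral_completion) measurable
  also have "\<dots> = (\<integral>w. (indicator B w * g w) * real_cond_exp M (natural t) (indicator J) w \<partial>M)"
  proof (rule F.real_cond_exp_intg(2)[symmetric])
    show "integrable M (\<lambda>x. indicator B x * g x * indicator J x)"
      by (rule integrable_const_bound[where B="\<bar>K\<bar>"])
        (use bound in \<open>auto simp: indicator_def intro!: AE_I2 order_trans[OF bound]\<close>)
    show "(\<lambda>w. indicator B w * g w) \<in> borel_measurable (natural t)"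
      using B(1) g by measurable
  qed measurable
  also have "\<dots> = (\<integral>w. (indicator B w * g w) * p h (\<xi> t w) j \<partial>M)"
    using markov[OF t j] by (intro integral_cong_AE) (auto simp: J_def elim!: eventually_mono)
  also have "\<dots> = (\<integral>w. (indicator B w * g w) * p h (\<xi> t w) j \<partial>completion M)"
    by (intro integral_completion[symmetric]) measurable
  also have "\<dots> = (\<integral>w. indicator A w * g w * p h (\<xi> t w) j \<partial>completion M)"
    using AE by (intro integral_cong_AE) (measurable, auto simp: indicator_def elim!: eventually_mono)
  finally show ?thesis unfolding J_def .
qed

section \<open>Euler sums of the log price and the discounted profile on the grid\<close>

definition speed :: "real \<Rightarrow> real" where "speed i = mu + sig * i"

text \<open>The left-endpoint rule makes the scheme predictable: the position with index
  \<open>Suc k\<close> depends on states up to time \<open>k * d\<close> only.\<close>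

definition euler :: "real \<Rightarrow> real \<Rightarrow> nat \<Rightarrow> 'a \<Rightarrow> real" where
  "euler d x k w = x + d * (\<Sum>i<k. speed (\<xi> (real i * d) w))"

lemma euler_0 [simp]: "euler d x 0 w = x"
  by (simp add: euler_def)

lemma euler_Suc: "euler d x (Suc k) w = euler d x k w + speed (\<xi> (real k * d) w) * d"
  by (simp add: euler_def algebra_simps)

lemma speed_bound: "i \<in> {-1, 1} \<Longrightarrow> \<bar>speed i\<bar> \<le> mu + sig"
  using mu_pos mu_less_sig by (auto simp: speed_def)

lemma euler_bound:
  assumes "w \<in> space M" "0 \<le> d"
  shows "\<bar>euler d x k w - x\<bar> \<le> real k * d * (mu + sig)"
proof -
  have "\<bar>\<Sum>i<k. speed (\<xi> (real i * d) w)\<bar> \<le> (\<Sum>i<k. mu + sig)"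
    using assms by (intro order_trans[OF sum_abs] sum_mono speed_bound state) auto
  then have "d * \<bar>\<Sum>i<k. speed (\<xi> (real i * d) w)\<bar> \<le> d * (\<Sum>i<k. mu + sig)"
    using assms by (intro mult_left_mono)
  then show ?thesis using assms by (simp add: euler_def abs_mult algebra_simps)
qed

lemma measurable_euler:
  assumes "0 \<le> d" "\<And>i. i < k \<Longrightarrow> real i * d \<le> t"
  shows "euler d x k \<in> borel_measurable (natural t)"
proof -
  have [measurable]: "\<xi> (real i * d) \<in> borel_measurable (natural t)" if "i \<in> {..<k}" for i
    using assms that by (intro measurable_natural) auto
  show ?thesis unfolding euler_def speed_def by measurable
qed

lemma measurable_euler_M [measurable]: "0 \<le> d \<Longrightarrow> euler d x k \<in> borel_measurable M"
  unfolding euler_def speed_def by (intro borel_measurable_add borel_measurable_times borel_measurable_sum borel_measurable_const measurable_state) auto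

end


context telegraph
begin

text \<open>Given the past at time \<open>k * d\<close>, the next position is already known and only
  the next state is random. Splitting over its two values reduces the claim to
  \<open>markov_step\<close>.\<close>

lemma euler_step:
  fixes f :: "real \<Rightarrow> real \<Rightarrow> real"
  assumes d: "0 \<le> d" and A: "A \<in> sets (completed (real k * d))"
    and cont: "\<And>i. continuous_on UNIV (f i)"
  shows "integrable (completion M) (\<lambda>w. f (\<xi> (real k * d) w) (euler d x k w))"
    and "(\<integral>w. indicator A w * f (\<xi> (real (Suc k) * d) w) (euler d x (Suc k) w) \<partial>completion M)
      = (\<integral>w. indicator A w * (p d (\<xi> (real k * d) w) 1 * f 1 (euler d x k w + speed (\<xi> (real k * d) w) * d)
          + p d (\<xi> (real k * d) w) (-1) * f (-1) (euler d x k w + speed (\<xi> (real k * d) w) * d)) \<partial>completion M)"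
    and "integrable (completion M) (\<lambda>w. indicator A w *
          (p d (\<xi> (real k * d) w) 1 * f 1 (euler d x k w + speed (\<xi> (real k * d) w) * d)
          + p d (\<xi> (real k * d) w) (-1) * f (-1) (euler d x k w + speed (\<xi> (real k * d) w) * d)))"
proof -
  have fm [measurable]: "f i \<in> borel_measurable borel" for i
    using cont by (intro borel_measurable_continuous_onI)
  \<comment> \<open>For fixed \<open>k\<close> the Euler position stays in a compact ball, on which
    a continuous profile is bounded even if it is unbounded on the line.\<close>
  have "\<exists>K. \<forall>w\<in>space M. \<bar>f j (euler d x k w)\<bar> \<le> K" for j k
  proof -
    have "compact (f j ` cball x (real k * d * (mu + sig)))"
      using cont by (intro compact_continuous_image continuous_on_subset[OF cont]) auto
    then obtain K where K: "\<And>v. v \<in> cball x (real k * d * (mu + sig)) \<Longrightarrow> norm (f j v) \<le> K"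
      using compact_imp_bounded bounded_iff by (metis image_eqI)
    then show ?thesis
      using euler_bound[OF _ d, of _ x k] by (intro exI[of _ K]) (auto simp: dist_real_def abs_minus_commute)
  qed
  then obtain K where K: "\<And>j k w. w \<in> space M \<Longrightarrow> \<bar>f j (euler d x k w)\<bar> \<le> K j k" by metis
  have state_meas: "\<xi> (real k * d) \<in> borel_measurable M" for k
    using d by (intro measurable_state) auto
  have fM: "(\<lambda>w. f (\<xi> (real k * d) w) (euler d x k w)) \<in> borel_measurable M" for k
    by (rule measurable_state_fun) (use d fm state_meas measurable_euler_M in auto)
  show "integrable (completion M) (\<lambda>w. f (\<xi> (real k * d) w) (euler d x k w))"
  proof (rule completion.integrable_const_bound[where B="max (K 1 k) (K (-1) k)"])
    have "norm (f (\<xi> (real k * d) w) (euler d x k w)) \<le> max (K 1 k) (K (-1) k)" if w: "w \<in> space M" for w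
      using state[OF w, of "real k * d"] K[OF w, of 1 k] K[OF w, of "-1" k] d by auto
    then show "AE w in completion M. norm (f (\<xi> (real k * d) w) (euler d x k w)) \<le> max (K 1 k) (K (-1) k)"
      by (intro AE_I2) simp
  qed (rule measurable_completion[OF fM])
  let ?t = "real k * d"
  have t: "0 \<le> ?t" using d by simp
  have Suc: "real (Suc k) * d = ?t + d" by (simp add: algebra_simps)
  define J where "J j = {v \<in> space M. \<xi> (?t + d) v = j}" for j
  have mJ: "J j \<in> sets M" for j
    unfolding J_def using state_meas[of "Suc k"] unfolding Suc by measurable
  have AC: "A \<in> sets (completion M)" using A completed_subset_completion by blast
  note mcompl [measurable] = sets_completionI_sets[OF mJ] AC
  \<comment> \<open>The shift by one matters: the position with index \<open>Suc k\<close> is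
    measurable at time \<open>k * d\<close>.\<close>
  have gN: "(\<lambda>w. f j (euler d x (Suc k) w)) \<in> borel_measurable (natural ?t)" for j
    by (intro measurable_compose[OF measurable_euler fm]) (use d in \<open>auto intro: mult_right_mono\<close>)
  have gM: "(\<lambda>w. f j (euler d x (Suc k) w)) \<in> borel_measurable M" for j
    by (intro measurable_compose[OF measurable_euler_M fm] d)
  note [measurable] = measurable_completion[OF gM]
  have pM: "(\<lambda>w. p d (\<xi> ?t w) j) \<in> borel_measurable M" for j
    by (rule measurable_state_fun[where F="\<lambda>i _. p d i j" and X="\<lambda>_. 0"]) (use t state_meas in auto)
  note [measurable] = measurable_completion[OF pM]
  have pb: "\<bar>p d (\<xi> ?t w) j\<bar> \<le> 1" if "j \<in> {-1, 1}" "w \<in> space M" for j w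
  proof -
    have "\<And>j. j \<in> {-1, 1} \<Longrightarrow> 0 \<le> p d (\<xi> ?t w) j" "(\<Sum>j\<in>{-1, 1}. p d (\<xi> ?t w) j) = 1"
      using semigroup state[OF that(2) t] d unfolding transition_semigroup_def by blast+
    then show ?thesis using that(1) by force
  qed
  have int: "integrable (completion M) (\<lambda>w. indicator A w * f j (euler d x (Suc k) w) * indicator (J j) w)" for j
    by (rule completion.integrable_const_bound[where B="\<bar>K j (Suc k)\<bar>"])
      (use K in \<open>auto simp: indicator_def intro!: AE_I2 order_trans[OF K]\<close>)
  have int': "integrable (completion M) (\<lambda>w. indicator A w * f j (euler d x (Suc k) w) * p d (\<xi> ?t w) j)"
    if j: "j \<in> {-1, 1}" for j
  proof (rule completion.integrable_const_bound[where B="\<bar>K j (Suc k)\<bar>"])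
    have "norm (indicator A w * f j (euler d x (Suc k) w) * p d (\<xi> ?t w) j) \<le> \<bar>K j (Suc k)\<bar>"
      if w: "w \<in> space M" for w
      using mult_mono[OF K[OF w, of j "Suc k"] pb[OF j w]] K[OF w, of j "Suc k"]
      by (auto simp: indicator_def abs_mult)
    then show "AE w in completion M. norm (indicator A w * f j (euler d x (Suc k) w) * p d (\<xi> ?t w) j) \<le> \<bar>K j (Suc k)\<bar>"
      by (intro AE_I2) simp
  qed measurable
  have "(\<integral>w. indicator A w * f (\<xi> (real (Suc k) * d) w) (euler d x (Suc k) w) \<partial>completion M)
    = (\<integral>w. indicator A w * f 1 (euler d x (Suc k) w) * indicator (J 1) w
        + indicator A w * f (-1) (euler d x (Suc k) w) * indicator (J (-1)) w \<partial>completion M)"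
  proof (rule Bochner_Integration.integral_cong[OF refl])
    fix w assume "w \<in> space (completion M)"
    then show "indicator A w * f (\<xi> (real (Suc k) * d) w) (euler d x (Suc k) w) =
      indicator A w * f 1 (euler d x (Suc k) w) * indicator (J 1) w
        + indicator A w * f (-1) (euler d x (Suc k) w) * indicator (J (-1)) w"
      using state[of w "?t + d"] t d unfolding Suc J_def by auto
  qed
  also have "\<dots> = (\<integral>w. indicator A w * f 1 (euler d x (Suc k) w) * indicator (J 1) w \<partial>completion M)
      + (\<integral>w. indicator A w * f (-1) (euler d x (Suc k) w) * indicator (J (-1)) w \<partial>completion M)"
    using int by (rule Bochner_Integration.integral_add) (rule int)
  also have "\<dots> = (\<integral>w. indicator A w * f 1 (euler d x (Suc k) w) * p d (\<xi> ?t w) 1 \<partial>completion M)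
      + (\<integral>w. indicator A w * f (-1) (euler d x (Suc k) w) * p d (\<xi> ?t w) (-1) \<partial>completion M)"
    unfolding J_def
    by (intro arg_cong2[where f="(+)"] markov_step[OF A t d _ gN K]) auto
  also have "\<dots> = (\<integral>w. indicator A w * f 1 (euler d x (Suc k) w) * p d (\<xi> ?t w) 1
      + indicator A w * f (-1) (euler d x (Suc k) w) * p d (\<xi> ?t w) (-1) \<partial>completion M)"
    using int'[of 1] int'[of "-1"] by simp
  finally show "(\<integral>w. indicator A w * f (\<xi> (real (Suc k) * d) w) (euler d x (Suc k) w) \<partial>completion M)
      = (\<integral>w. indicator A w * (p d (\<xi> (real k * d) w) 1 * f 1 (euler d x k w + speed (\<xi> (real k * d) w) * d)
          + p d (\<xi> (real k * d) w) (-1) * f (-1) (euler d x k w + speed (\<xi> (real k * d) w) * d)) \<partial>completion M)"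
    by (simp add: euler_Suc algebra_simps)
  have "integrable (completion M) (\<lambda>w. indicator A w * f 1 (euler d x (Suc k) w) * p d (\<xi> ?t w) 1
      + indicator A w * f (-1) (euler d x (Suc k) w) * p d (\<xi> ?t w) (-1))"
    using int'[of 1] int'[of "-1"] by simp
  then show "integrable (completion M) (\<lambda>w. indicator A w *
          (p d (\<xi> (real k * d) w) 1 * f 1 (euler d x k w + speed (\<xi> (real k * d) w) * d)
          + p d (\<xi> (real k * d) w) (-1) * f (-1) (euler d x k w + speed (\<xi> (real k * d) w) * d)))"
    by (simp add: euler_Suc algebra_simps)
qed

definition discounted :: "(real \<Rightarrow> real \<Rightarrow> real) \<Rightarrow> real \<Rightarrow> real \<Rightarrow> real \<Rightarrow> nat \<Rightarrow> 'a \<Rightarrow> real" where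
  "discounted f r d x k w = exp (- r * (real k * d)) * f (\<xi> (real k * d) w) (euler d x k w)"

text \<open>The discount \<open>exp (- r * d)\<close> per step cancels the factor
  \<open>exp (r * d)\<close> in \<open>step\<close>, so \<open>sg\<close> times the discounted
  profile decreases in mean until \<open>Q\<close> occurs. The one-step inequality is required only
  on \<open>U\<close>, where the position lies as long as \<open>Q\<close> fails.\<close>

lemma stopped_euler_bound:
  fixes f :: "real \<Rightarrow> real \<Rightarrow> real"
  assumes d: "0 \<le> d" and sg: "sg = 1 \<or> sg = -1"
    and cont: "\<And>i. continuous_on UNIV (f i)"
    and Q: "\<And>k. {w \<in> space M. Q k w} \<in> sets (completed (real k * d))"
    and region: "\<And>w k. w \<in> space M \<Longrightarrow> \<not> Q k w \<Longrightarrow> euler d x k w \<in> U (\<xi> (real k * d) w)"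
    and step: "\<And>i y. i \<in> {-1, 1} \<Longrightarrow> y \<in> U i \<Longrightarrow>
      sg * (p d i 1 * f 1 (y + speed i * d) + p d i (-1) * f (-1) (y + speed i * d)) \<le> sg * (exp (r * d) * f i y)"
  shows "integrable (completion M) (\<lambda>w. discounted f r d x (first_time Q n w) w)
    \<and> sg * (\<integral>w. discounted f r d x (first_time Q n w) w \<partial>completion M) \<le> sg * f s x"
proof -
  define Z where "Z k w = sg * discounted f r d x k w" for k w
  have Zint: "integrable (completion M) (Z k)" for k
    unfolding Z_def discounted_def
    by (intro integrable_mult_right impI euler_step(1)[OF d sets.top cont])
  have main: "integrable (completion M) (\<lambda>w. Z (first_time Q n w) w) \<and>
      (\<integral>w. Z (first_time Q n w) w \<partial>completion M) \<le> (\<integral>w. Z 0 w \<partial>completion M)"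
  proof (rule optional_stopping[OF Zint])
    show "{w \<in> space (completion M). Q k w} \<in> sets (completion M)" for k
      using Q[of k] completed_subset_completion by auto
  next
    fix k
    define A where "A = {w \<in> space (completion M). \<forall>i\<le>k. \<not> Q i w}"
    let ?t = "real k * d"
    have [measurable]: "Measurable.pred (completed ?t) (Q i)" if "i \<in> {..k}" for i
    proof -
      have "{w \<in> space M. Q i w} \<in> sets (completed ?t)"
      proof (rule subsetD[OF completed_mono Q])
        show "ennreal (real i * d) \<le> ennreal ?t"
          using d that by (intro ennreal_leI mult_right_mono) auto
      qed
      then show ?thesis by (simp add: pred_def)
    qed
    have "{w \<in> space (completed ?t). \<forall>i\<in>{..k}. \<not> Q i w} \<in> sets (completed ?t)" by measurable
    also have "{w \<in> space (completed ?t). \<forall>i\<in>{..k}. \<not> Q i w} = A" by (auto simp: A_def)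
    finally have A: "A \<in> sets (completed ?t)" .
    have AC: "A \<in> sets (completion M)" using A completed_subset_completion by blast
    have int: "integrable (completion M) (\<lambda>w. indicator A w * Z k w)" for k
      using integrable_mult_indicator[OF AC Zint[of k]] by simp
    define S where "S w = p d (\<xi> ?t w) 1 * f 1 (euler d x k w + speed (\<xi> ?t w) * d)
          + p d (\<xi> ?t w) (-1) * f (-1) (euler d x k w + speed (\<xi> ?t w) * d)" for w
    let ?c = "sg * exp (- r * (real (Suc k) * d))"
    have "(\<integral>w. indicator A w * (Z (Suc k) w - Z k w) \<partial>completion M)
       = (\<integral>w. indicator A w * Z (Suc k) w \<partial>completion M) - (\<integral>w. indicator A w * Z k w \<partial>completion M)"
      using int by (simp add: right_diff_distrib Bochner_Integration.integral_diff)
    also have "(\<integral>w. indicator A w * Z (Suc k) w \<partial>completion M)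
      = (\<integral>w. ?c * (indicator A w * f (\<xi> (real (Suc k) * d) w) (euler d x (Suc k) w)) \<partial>completion M)"
      by (simp add: Z_def discounted_def ac_simps)
    also have "\<dots> = ?c * (\<integral>w. indicator A w * S w \<partial>completion M)"
      using euler_step(2)[where f=f and x=x, OF d A cont] by (simp add: S_def)
    also have "\<dots> = (\<integral>w. ?c * (indicator A w * S w) \<partial>completion M)"
      by simp
    also have "\<dots> \<le> (\<integral>w. indicator A w * Z k w \<partial>completion M)"
    proof (rule integral_mono_AE)
      show "AE w in completion M. ?c * (indicator A w * S w) \<le> indicator A w * Z k w"
      proof (rule AE_I2)
        fix w assume w: "w \<in> space (completion M)"
        show "?c * (indicator A w * S w) \<le> indicator A w * Z k w"
        proof (cases "w \<in> A")
          case True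
          then have "sg * S w \<le> sg * (exp (r * d) * f (\<xi> ?t w) (euler d x k w))"
            unfolding S_def using w d by (intro step state region) (auto simp: A_def)
          then have "exp (- r * (real (Suc k) * d)) * (sg * S w)
              \<le> exp (- r * (real (Suc k) * d)) * (sg * (exp (r * d) * f (\<xi> ?t w) (euler d x k w)))"
            by (rule mult_left_mono) simp
          also have "\<dots> = sg * (exp (- r * (real (Suc k) * d)) * exp (r * d)) * f (\<xi> ?t w) (euler d x k w)"
            by simp
          also have "\<dots> = Z k w"
            unfolding Z_def discounted_def by (simp add: algebra_simps flip: exp_add)
          finally show ?thesis using True by (simp add: ac_simps)
        qed simp
      qed
    next
      show "integrable (completion M) (\<lambda>w. ?c * (indicator A w * S w))"
        unfolding S_def by (intro integrable_mult_right impI euler_step(3)[OF d A cont])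
      show "integrable (completion M) (\<lambda>w. indicator A w * Z k w)" by (rule int)
    qed
    finally show "(\<integral>w. indicator {w \<in> space (completion M). \<forall>i\<le>k. \<not> Q i w} w * (Z (Suc k) w - Z k w) \<partial>completion M) \<le> 0"
      by (simp add: A_def)
  qed
  have "(\<integral>w. Z 0 w \<partial>completion M) = (\<integral>w. sg * f s x \<partial>completion M)"
  proof (rule integral_cong_AE)
    show "AE w in completion M. Z 0 w = sg * f s x"
      unfolding AE_completion_iff using start(2)
      by eventually_elim (simp add: Z_def discounted_def)
  qed (use Zint[of 0] in auto)
  moreover have "integrable (completion M) (\<lambda>w. discounted f r d x (first_time Q n w) w)"
    using conjunct1[OF main] sg unfolding Z_def by (subst (asm) integrable_mult_left_iff) auto
  ultimately show ?thesis
    using main sg by (auto simp: Z_def prob_space)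
qed

end


section \<open>Riemann sums of step paths\<close>

lemma step_path_pieceE:
  assumes T: "T (0::nat) = (0::real)" "filterlim T at_top sequentially" and "0 \<le> t"
  obtains n where "T n \<le> t" "t < T (Suc n)"
proof -
  have ex: "\<exists>k. t < T k"
    using eventually_happens[OF filterlim_at_top_dense[THEN iffD1, rule_format, OF T(2), of t]] by auto
  define k where "k = (LEAST k. t < T k)"
  have k: "t < T k" unfolding k_def by (rule LeastI_ex[OF ex])
  with assms obtain n where n: "k = Suc n" by (cases k) auto
  have "\<not> t < T n" using not_less_Least[of n "\<lambda>k. t < T k"] n by (simp add: k_def)
  with k n show ?thesis by (intro that[of n]) auto
qed

text \<open>For grid times that approach \<open>t\<close> from above: the state seen there is
  eventually the state at \<open>t\<close>.\<close>

lemma step_path_right_constant: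
  assumes "step_path x" "0 \<le> t"
  obtains e :: real where "0 < e" "\<And>u. t \<le> u \<Longrightarrow> u < t + e \<Longrightarrow> x u = x t"
proof -
  from assms obtain T where T: "T 0 = 0" "strict_mono T" "filterlim T at_top sequentially"
    and c: "\<And>n t. t \<in> {T n..<T (Suc n)} \<Longrightarrow> x t = x (T n)"
    unfolding step_path_def by blast
  obtain n where n: "T n \<le> t" "t < T (Suc n)" using step_path_pieceE[OF T(1,3) assms(2)] .
  show ?thesis
  proof (rule that[of "T (Suc n) - t"])
    fix u assume "t \<le> u" "u < t + (T (Suc n) - t)"
    then show "x u = x t" using c[of u n] c[of t n] n by simp
  qed (use n in simp)
qed

lemma step_path_integrable:
  fixes x :: "real \<Rightarrow> real"
  assumes "step_path x" "0 \<le> a"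
  shows "x integrable_on {a..b}"
proof -
  from assms obtain T where T: "T 0 = 0" "strict_mono T" "filterlim T at_top sequentially"
    and c: "\<And>n t. t \<in> {T n..<T (Suc n)} \<Longrightarrow> x t = x (T n)"
    unfolding step_path_def by blast
  have "x integrable_on {0..T n}" for n
  proof (induction n)
    case 0
    then show ?case using integrable_on_refl[of x 0] by (simp add: T(1))
  next
    case (Suc n)
    have le: "T n \<le> T (Suc n)" "0 \<le> T n"
      using strict_mono_less_eq[OF T(2)] T(1) by (auto, metis le0)
    have "(\<lambda>_. x (T n)) integrable_on {T n..T (Suc n)}"
      by (rule integrable_const_ivl)
    then have "x integrable_on {T n..T (Suc n)}"
      by (rule integrable_spike_finite[of "{T (Suc n)}", rotated 2]) (use c in auto)
    then show ?case
      using Henstock_Kurzweil_Integration.integrable_combine[OF le(2,1) Suc] by blast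
  qed
  moreover obtain n where "b < T n"
    using eventually_happens[OF filterlim_at_top_dense[THEN iffD1, rule_format, OF T(3), of b]] by auto
  ultimately have "x integrable_on {0..T n}" "{a..b} \<subseteq> {0..T n}" using assms(2) by auto
  then show ?thesis by (rule integrable_on_subinterval)
qed

lemma integral_increment_bound:
  fixes x :: "real \<Rightarrow> real"
  assumes "step_path x" and "\<And>t. 0 \<le> t \<Longrightarrow> \<bar>x t\<bar> \<le> 1" and "0 \<le> a" "a \<le> b"
  shows "\<bar>integral {0..b} x - integral {0..a} x\<bar> \<le> b - a"
proof -
  have "integral {0..a} x + integral {a..b} x = integral {0..b} x"
    using assms by (intro Henstock_Kurzweil_Integration.integral_combine step_path_integrable) auto
  moreover have "norm (integral {a..b} x) \<le> integral {a..b} (\<lambda>_. 1)"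
    using assms by (intro integral_norm_bound_integral step_path_integrable[OF assms(1)]) auto
  ultimately show ?thesis using assms by simp
qed

text \<open>The Riemann sum errs only on the grid cells that contain a jump, by at most \<open>2 d\<close> on each.\<close>

lemma step_path_riemann_sum:
  fixes x :: "real \<Rightarrow> real"
  assumes x: "step_path x" and bound: "\<And>t. 0 \<le> t \<Longrightarrow> \<bar>x t\<bar> \<le> 1"
  obtains J where "0 \<le> J"
    "\<And>d k. 0 < d \<Longrightarrow> real k * d \<le> S \<Longrightarrow> \<bar>integral {0..real k * d} x - d * (\<Sum>i<k. x (real i * d))\<bar> \<le> J * d"
proof -
  from x obtain T where T: "T 0 = 0" "strict_mono T" "filterlim T at_top sequentially"
    and c: "\<And>n t. t \<in> {T n..<T (Suc n)} \<Longrightarrow> x t = x (T n)"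
    unfolding step_path_def by blast
  obtain m where m: "S < T m"
    using eventually_happens[OF filterlim_at_top_dense[THEN iffD1, rule_format, OF T(3), of S]] by auto
  show ?thesis
  proof (rule that[of "2 * real m"])
    fix d :: real and k :: nat assume d: "0 < d" and kS: "real k * d \<le> S"
    \<comment> \<open>Cells are open on the left because a jump at \<open>i * d\<close> is already
      seen by the sample \<open>x (i * d)\<close>. They are disjoint, so each jump is charged to at
      most one cell.\<close>
    define cell where "cell i = {real i * d<..real (Suc i) * d}" for i
    have err: "\<bar>integral {real i * d..real (Suc i) * d} x - d * x (real i * d)\<bar>
        \<le> 2 * d * (\<Sum>n<m. of_bool (T n \<in> cell i))" if i: "i < k" for i
    proof (cases "\<exists>n<m. T n \<in> cell i")
      case True
      then obtain n where n: "n < m" "T n \<in> cell i" by blast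
      have "\<bar>integral {0..real (Suc i) * d} x - integral {0..real i * d} x\<bar> \<le> real (Suc i) * d - real i * d"
        using d by (intro integral_increment_bound[OF x bound]) (auto intro: mult_right_mono)
      moreover have "integral {0..real i * d} x + integral {real i * d..real (Suc i) * d} x = integral {0..real (Suc i) * d} x"
        using d by (intro Henstock_Kurzweil_Integration.integral_combine step_path_integrable[OF x])
          (auto intro: mult_right_mono)
      moreover have "\<bar>d * x (real i * d)\<bar> \<le> d"
        using d bound[of "real i * d"] by (auto simp: abs_mult mult_le_cancel_left1)
      ultimately have "\<bar>integral {real i * d..real (Suc i) * d} x - d * x (real i * d)\<bar> \<le> 2 * d"
        by (simp add: algebra_simps)
      also have "\<dots> \<le> 2 * d * (\<Sum>n<m. of_bool (T n \<in> cell i))"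
        using member_le_sum[of n "{..<m}" "\<lambda>n. of_bool (T n \<in> cell i) :: real"] n d
        by (simp add: mult_le_cancel_left1)
      finally show ?thesis .
    next
      case False
      have id0: "0 \<le> real i * d" using d by simp
      obtain n where n: "T n \<le> real i * d" "real i * d < T (Suc n)"
        using step_path_pieceE[OF T(1,3) id0] .
      have "real (Suc i) * d \<le> real k * d" using i d by (intro mult_right_mono) auto
      \<comment> \<open>Otherwise the next jump time \<open>T (Suc n)\<close> would lie in the cell
        and, being at most \<open>S\<close>, have an index below \<open>m\<close>, against the case
        assumption.\<close>
      have less: "real (Suc i) * d < T (Suc n)"
      proof (rule ccontr)
        assume *: "\<not> real (Suc i) * d < T (Suc n)"
        then have "T (Suc n) < T m"
          using m kS \<open>real (Suc i) * d \<le> real k * d\<close> by linarith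
        then have "Suc n < m" using strict_mono_less[OF T(2)] by simp
        with False * n show False by (auto simp: cell_def)
      qed
      have "integral {real i * d..real (Suc i) * d} x = integral {real i * d..real (Suc i) * d} (\<lambda>_. x (real i * d))"
      proof (rule Henstock_Kurzweil_Integration.integral_cong)
        fix u assume u: "u \<in> {real i * d..real (Suc i) * d}"
        then show "x u = x (real i * d)"
          using c[of u n] c[of "real i * d" n] n less by simp
      qed
      also have "\<dots> = d * x (real i * d)"
        using d by (simp add: algebra_simps)
      finally show ?thesis using d by (simp add: sum_nonneg)
    qed
    have split: "integral {0..real k * d} x = (\<Sum>i<k. integral {real i * d..real (Suc i) * d} x)" for k
    proof (induction k)
      case (Suc k)
      have "integral {0..real k * d} x + integral {real k * d..real (Suc k) * d} x = integral {0..real (Suc k) * d} x"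
        using d by (intro Henstock_Kurzweil_Integration.integral_combine step_path_integrable[OF x])
          (auto intro: mult_right_mono)
      with Suc show ?case by simp
    qed simp
    have "\<bar>integral {0..real k * d} x - d * (\<Sum>i<k. x (real i * d))\<bar>
      = \<bar>\<Sum>i<k. integral {real i * d..real (Suc i) * d} x - d * x (real i * d)\<bar>"
      by (simp add: split sum_subtractf sum_distrib_left)
    also have "\<dots> \<le> (\<Sum>i<k. 2 * d * (\<Sum>n<m. of_bool (T n \<in> cell i)))"
      by (intro order_trans[OF sum_abs] sum_mono err) simp
    also have "\<dots> = 2 * d * (\<Sum>n<m. \<Sum>i<k. of_bool (T n \<in> cell i))"
      unfolding sum_distrib_left[symmetric] by (subst sum.swap) (rule refl)
    also have "\<dots> \<le> 2 * d * (\<Sum>n<m. 1)"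
    proof (intro mult_left_mono sum_mono)
      fix n
      have uniq: "i = j" if "T n \<in> cell i" "T n \<in> cell j" for i j
      proof -
        have "real i * d < real (Suc j) * d" "real j * d < real (Suc i) * d"
          using that by (auto simp: cell_def simp del: of_nat_Suc)
        then have "i < Suc j" "j < Suc i" using d by (simp_all only: mult_less_cancel_right_pos of_nat_less_iff)
        then show ?thesis by simp
      qed
      have "card ({..<k} \<inter> {i. T n \<in> cell i}) \<le> 1"
        using uniq by (subst One_nat_def, subst card_le_Suc0_iff_eq) auto
      then show "(\<Sum>i<k. of_bool (T n \<in> cell i)) \<le> (1::real)"
        by simp
    qed (use d in simp)
    finally show "\<bar>integral {0..real k * d} x - d * (\<Sum>i<k. x (real i * d))\<bar> \<le> 2 * real m * d"
      by (simp add: algebra_simps)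
  qed simp
qed


section \<open>The log price and its Euler approximation\<close>

text \<open>\<open>z\<close> is the one place where a kink is allowed. The derivative bound makes
  changes along the flow small relative to \<open>f i x\<close>; the ratio bound does the same for
  the contribution of the other state.\<close>

definition log_lipschitz_profile :: "(real \<Rightarrow> real \<Rightarrow> real) \<Rightarrow> (real \<Rightarrow> real \<Rightarrow> real) \<Rightarrow> real \<Rightarrow> bool" where
  "log_lipschitz_profile f f' z \<longleftrightarrow> (\<forall>i. continuous_on UNIV (f i)) \<and> (\<forall>i x. 0 < f i x) \<and>
    (\<forall>i x. x \<noteq> z \<longrightarrow> (f i has_real_derivative f' i x) (at x)) \<and>
    (\<exists>K\<ge>0. \<forall>i x. x \<noteq> z \<longrightarrow> \<bar>f' i x\<bar> \<le> K * f i x) \<and>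
    (\<exists>R\<ge>0. \<forall>i x. f (- i) x \<le> R * f i x)"

context telegraph
begin

lemma state_le_1: "w \<in> space M \<Longrightarrow> 0 \<le> t \<Longrightarrow> \<bar>\<xi> t w\<bar> \<le> 1"
  using state[of w t] by auto

definition log_price :: "real \<Rightarrow> real \<Rightarrow> 'a \<Rightarrow> real" where
  "log_price x t w = x + (mu * t + sig * integral {0..t} (\<lambda>u. \<xi> u w))"

lemma price_eq_exp: "price mu sig \<xi> (exp x) t w = exp (log_price x t w)"
  by (simp add: price_def log_price_def exp_add)

lemma log_price_increment:
  assumes w: "w \<in> space M" and "0 \<le> t" "t \<le> u"
  shows "\<bar>log_price x u w - log_price x t w\<bar> \<le> (mu + sig) * (u - t)"
proof -
  have "log_price x u w - log_price x t w
    = mu * (u - t) + sig * (integral {0..u} (\<lambda>u. \<xi> u w) - integral {0..t} (\<lambda>u. \<xi> u w))"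
    by (simp add: log_price_def algebra_simps)
  moreover have "\<bar>mu * (u - t)\<bar> = mu * (u - t)"
    using assms mu_pos by simp
  moreover have "\<bar>sig * (integral {0..u} (\<lambda>u. \<xi> u w) - integral {0..t} (\<lambda>u. \<xi> u w))\<bar> \<le> sig * (u - t)"
    unfolding abs_mult using assms mu_pos mu_less_sig
    by (intro mult_mono integral_increment_bound step_path state_le_1) auto
  ultimately show ?thesis by (simp add: algebra_simps)
qed

text \<open>\<open>J\<close> depends on the path and on the horizon, but not on \<open>d\<close> or
  \<open>k\<close>; this gives convergence path by path.\<close>

lemma euler_error:
  assumes w: "w \<in> space M"
  obtains J where "0 \<le> J"
    "\<And>d k. 0 < d \<Longrightarrow> real k * d \<le> S \<Longrightarrow> \<bar>euler d x k w - log_price x (real k * d) w\<bar> \<le> J * d"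
proof -
  obtain J where J: "0 \<le> J" "\<And>d k. 0 < d \<Longrightarrow> real k * d \<le> S \<Longrightarrow>
      \<bar>integral {0..real k * d} (\<lambda>u. \<xi> u w) - d * (\<Sum>i<k. \<xi> (real i * d) w)\<bar> \<le> J * d"
    using step_path_riemann_sum[OF step_path[OF w] state_le_1[OF w]] by metis
  show ?thesis
  proof (rule that[of "sig * J"])
    fix d k assume *: "0 < d" "real k * d \<le> S"
    have "euler d x k w = x + (mu * (real k * d) + sig * (d * (\<Sum>i<k. \<xi> (real i * d) w)))"
      by (simp add: euler_def speed_def sum.distrib sum_distrib_left[symmetric] distrib_left)
    then have "euler d x k w - log_price x (real k * d) w
      = - sig * (integral {0..real k * d} (\<lambda>u. \<xi> u w) - d * (\<Sum>i<k. \<xi> (real i * d) w))"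
      by (simp add: log_price_def algebra_simps)
    then show "\<bar>euler d x k w - log_price x (real k * d) w\<bar> \<le> sig * J * d"
      using J(2)[OF *] mu_pos mu_less_sig by (simp add: abs_mult)
  qed (use J mu_pos mu_less_sig in simp)
qed

text \<open>Measurability in \<open>w\<close> of the pathwise integral comes from writing it as the
  limit of Euler sums of mesh \<open>t / Suc n\<close>. The case \<open>t = 0\<close> is separate
  since the mesh must be positive.\<close>

lemma measurable_log_price:
  assumes "0 \<le> t"
  shows "log_price x t \<in> borel_measurable M"
proof (cases "t = 0")
  case True
  then have "log_price x t = (\<lambda>_. x)" by (simp add: log_price_def fun_eq_iff)
  then show ?thesis by simp
next
  case False
  with assms have t: "0 < t" by simp
  show ?thesis
  proof (rule borel_measurable_LIMSEQ_real)
    show "euler (t / real (Suc n)) x (Suc n) \<in> borel_measurable M" for n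
      using t by (intro measurable_euler_M) simp
    fix w assume w: "w \<in> space M"
    obtain J where J: "\<And>d k. 0 < d \<Longrightarrow> real k * d \<le> t \<Longrightarrow> \<bar>euler d x k w - log_price x (real k * d) w\<bar> \<le> J * d"
      using euler_error[OF w, where S=t and x=x] by metis
    have "(\<lambda>n. euler (t / real (Suc n)) x (Suc n) w - log_price x t w) \<longlonglongrightarrow> 0"
    proof (rule Lim_null_comparison)
      show "\<forall>\<^sub>F n in sequentially. norm (euler (t / real (Suc n)) x (Suc n) w - log_price x t w) \<le> J * (t / real (Suc n))"
      proof (intro always_eventually allI)
        fix n
        have "real (Suc n) * (t / real (Suc n)) = t" by simp
        then show "norm (euler (t / real (Suc n)) x (Suc n) w - log_price x t w) \<le> J * (t / real (Suc n))"
          using J[of "t / real (Suc n)" "Suc n"] t by (simp del: of_nat_Suc)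
      qed
      show "(\<lambda>n. J * (t / real (Suc n))) \<longlonglongrightarrow> 0"
        using tendsto_mult_right_zero[OF LIMSEQ_inverse_real_of_nat, of "J * t"] by (simp add: field_simps)
    qed
    then show "(\<lambda>n. euler (t / real (Suc n)) x (Suc n) w) \<longlonglongrightarrow> log_price x t w"
      by (rule LIM_zero_cancel)
  qed
qed

text \<open>The grid times approach \<open>t\<close> from the right, which matches the right
  continuity of the chain; from the left the state could converge to its value before a
  jump.\<close>

lemma euler_tendsto_log_price:
  fixes d :: "nat \<Rightarrow> real"
  assumes w: "w \<in> space M" and t: "0 \<le> t" and d: "d \<longlonglongrightarrow> 0" "\<And>n. 0 < d n"
    and k: "\<forall>\<^sub>F n in sequentially. t \<le> real (k n) * d n \<and> real (k n) * d n \<le> t + d n"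
  shows "(\<lambda>n. euler (d n) x (k n) w) \<longlonglongrightarrow> log_price x t w"
    and "\<forall>\<^sub>F n in sequentially. \<xi> (real (k n) * d n) w = \<xi> t w"
    and "(\<lambda>n. real (k n) * d n) \<longlonglongrightarrow> t"
proof -
  obtain J where J: "\<And>d k. 0 < d \<Longrightarrow> real k * d \<le> t + 1 \<Longrightarrow> \<bar>euler d x k w - log_price x (real k * d) w\<bar> \<le> J * d"
    using euler_error[OF w, where S="t + 1" and x=x] by metis
  have d1: "\<forall>\<^sub>F n in sequentially. d n < 1"
    using d(1) by (rule order_tendstoD) simp
  have "(\<lambda>n. euler (d n) x (k n) w - log_price x t w) \<longlonglongrightarrow> 0"
  proof (rule Lim_null_comparison)
    show "\<forall>\<^sub>F n in sequentially. norm (euler (d n) x (k n) w - log_price x t w) \<le> J * d n + (mu + sig) * d n"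
      using k d1
    proof eventually_elim
      case (elim n)
      have "\<bar>euler (d n) x (k n) w - log_price x (real (k n) * d n) w\<bar> \<le> J * d n"
        using elim d(2) by (intro J) auto
      moreover have "\<bar>log_price x (real (k n) * d n) w - log_price x t w\<bar> \<le> (mu + sig) * (real (k n) * d n - t)"
        using elim t by (intro log_price_increment[OF w]) auto
      moreover have "(mu + sig) * (real (k n) * d n - t) \<le> (mu + sig) * d n"
        using elim mu_pos mu_less_sig by (intro mult_left_mono) auto
      ultimately show ?case by simp
    qed
    show "(\<lambda>n. J * d n + (mu + sig) * d n) \<longlonglongrightarrow> 0"
      using d(1) by (auto intro!: tendsto_eq_intros)
  qed
  then show "(\<lambda>n. euler (d n) x (k n) w) \<longlonglongrightarrow> log_price x t w"
    by (rule LIM_zero_cancel)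
  obtain e where e: "0 < e" "\<And>u. t \<le> u \<Longrightarrow> u < t + e \<Longrightarrow> \<xi> u w = \<xi> t w"
    using step_path_right_constant[OF step_path[OF w] t] by metis
  have "\<forall>\<^sub>F n in sequentially. d n < e"
    using d(1) e(1) by (rule order_tendstoD)
  with k show "\<forall>\<^sub>F n in sequentially. \<xi> (real (k n) * d n) w = \<xi> t w"
    by eventually_elim (auto intro: e(2))
  show "(\<lambda>n. real (k n) * d n) \<longlonglongrightarrow> t"
  proof (rule tendsto_sandwich)
    show "\<forall>\<^sub>F n in sequentially. t \<le> real (k n) * d n" using k by eventually_elim simp
    show "\<forall>\<^sub>F n in sequentially. real (k n) * d n \<le> t + d n" using k by eventually_elim simp
    show "(\<lambda>n. t + d n) \<longlonglongrightarrow> t" using d(1) by (auto intro!: tendsto_eq_intros)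
  qed simp
qed

text \<open>The off-diagonal entry \<open>p d i (- i)\<close> enters through its right derivative
  \<open>lam\<close> at 0; the row sum then gives the diagonal entry.\<close>

lemma step_condition:
  fixes f :: "real \<Rightarrow> real \<Rightarrow> real"
  assumes prof: "log_lipschitz_profile f f' z" and "0 < eps" and sg: "sg = 1 \<or> sg = -1"
    and flow: "\<And>i x t. i \<in> {-1, 1} \<Longrightarrow> x \<in> U i \<Longrightarrow> 0 \<le> t \<Longrightarrow> x + speed i * t \<in> U i"
    and gen: "\<And>i x. i \<in> {-1, 1} \<Longrightarrow> x \<in> U i \<Longrightarrow> x \<noteq> z \<Longrightarrow>
      sg * (speed i * f' i x) \<le> sg * ((lam + r) * f i x - lam * f (- i) x)"
  shows "\<forall>\<^sub>F d in at_right 0. \<forall>i\<in>{-1, 1}. \<forall>x\<in>U i.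
    sg * (p d i 1 * f 1 (x + speed i * d) + p d i (-1) * f (-1) (x + speed i * d))
      \<le> sg * (exp ((r + sg * eps) * d) * f i x)"
proof -
  from prof obtain K R where K: "0 \<le> K" "\<And>i x. x \<noteq> z \<Longrightarrow> \<bar>f' i x\<bar> \<le> K * f i x"
    and R: "0 \<le> R" "\<And>i x. f (- i) x \<le> R * f i x"
    and cont: "\<And>i. continuous_on UNIV (f i)" and fpos: "\<And>i x. 0 < f i x"
    and deriv: "\<And>i x. x \<noteq> z \<Longrightarrow> (f i has_real_derivative f' i x) (at x)"
    unfolding log_lipschitz_profile_def by blast
  have one: "\<forall>\<^sub>F d in at_right 0. \<forall>x\<in>U i.
      sg * (p d i 1 * f 1 (x + speed i * d) + p d i (-1) * f (-1) (x + speed i * d))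
      \<le> sg * (exp ((r + sg * eps) * d) * f i x)" if i: "i \<in> {-1, 1}" for i
  proof -
    have mi: "- i \<in> {-1, 1}" "i \<noteq> - i" using i by auto
    have lip: "f j y \<le> exp (K * \<bar>y - x\<bar>) * f j x" for j x y
      by (rule log_lipschitz_bound[OF cont deriv K(2)])
    have "((\<lambda>t. p t i (- i)) has_real_derivative flip_generator lam i (- i)) (at 0 within {0..})"
      "p 0 i (- i) = of_bool (i = - i)"
      using semigroup i mi unfolding transition_semigroup_def by blast+
    then have "((\<lambda>t. p t i (- i)) has_real_derivative lam) (at 0 within {0<..})" "p 0 i (- i) = 0"
      using mi by (auto simp: flip_generator_def elim: has_field_derivative_subset)
    then have q: "((\<lambda>d. p d i (- i) / d) \<longlongrightarrow> lam) (at_right 0)"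
      by (simp add: has_field_derivative_iff)
    have "speed i \<noteq> 0" using i mu_pos mu_less_sig by (auto simp: speed_def)
    from one_step_estimate[where f="f i" and f'="f' i" and h="f (- i)" and U="U i",
        OF this lam_pos K(1) R(1) \<open>0 < eps\<close> sg cont deriv lip lip fpos fpos R(2) flow[OF i] gen[OF i] q]
    have "\<forall>\<^sub>F d in at_right 0. \<forall>x\<in>U i. sg * ((1 - p d i (- i)) * f i (x + speed i * d) + p d i (- i) * f (- i) (x + speed i * d))
      \<le> sg * (exp ((r + sg * eps) * d) * f i x)" by blast
    then show ?thesis
      using eventually_at_right_less[of "0::real"]
    proof eventually_elim
      case (elim d)
      have "(\<Sum>j\<in>{-1, 1}. p d i j) = 1"
        using semigroup i elim(2) unfolding transition_semigroup_def by (meson less_imp_le)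
      then have "p d i i = 1 - p d i (- i)" using i by auto
      then have "p d i 1 * f 1 y + p d i (-1) * f (-1) y = (1 - p d i (- i)) * f i y + p d i (- i) * f (- i) y" for y
        using i by auto
      then show ?case using elim(1) by simp
    qed
  qed
  have "(1::real) \<in> {-1, 1}" "(-1::real) \<in> {-1, 1}" by simp_all
  from one[OF this(1)] one[OF this(2)] show ?thesis by eventually_elim auto
qed

end


section \<open>Upper and lower bounds for the value\<close>

context telegraph
begin

lemma hitting_event:
  assumes "stopping_time (completed_natural_filtration M \<xi>) tau"
  shows "{w \<in> space M. tau w \<le> ennreal t} \<in> sets (completed t)"
  using stopping_timeD[OF assms, of "ennreal t"] by (simp add: pred_def)

text \<open>Rounding \<open>tau\<close> up to the grid gives an adapted stopping index, since
  \<open>tau \<le> k * d\<close> is known at time \<open>k * d\<close>. The bound holds for each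
  mesh at rate \<open>r + eps n\<close> and survives the limit by Fatou, as \<open>f\<close> is
  positive.\<close>

lemma expected_profile_le:
  fixes tau :: "'a \<Rightarrow> ennreal"
  assumes prof: "log_lipschitz_profile f f' z"
    and gen: "\<And>i y. i \<in> {-1, 1} \<Longrightarrow> y \<noteq> z \<Longrightarrow> speed i * f' i y \<le> (lam + r) * f i y - lam * f (- i) y"
    and tau: "stopping_time (completed_natural_filtration M \<xi>) tau"
  shows "(\<integral>\<^sup>+w. (if tau w = \<infinity> then 0 else ennreal (exp (- r * enn2real (tau w))
      * f (\<xi> (enn2real (tau w)) w) (log_price x (enn2real (tau w)) w))) \<partial>completion M) \<le> ennreal (f s x)"
    (is "(\<integral>\<^sup>+w. ?H w \<partial>_) \<le> _")
proof -
  have cont: "\<And>i. continuous_on UNIV (f i)" and fpos: "\<And>i y. 0 < f i y"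
    using prof by (auto simp: log_lipschitz_profile_def)
  define eps where "eps n = inverse (real (Suc n))" for n
  have eps: "0 < eps n" for n by (simp add: eps_def)
  have eps0: "eps \<longlonglongrightarrow> 0" unfolding eps_def by (rule LIMSEQ_inverse_real_of_nat)
  \<comment> \<open>The mesh is chosen after \<open>eps n\<close>, so that the one-step inequality
    holds at rate \<open>r + eps n\<close>; \<open>d < eps n\<close> forces the meshes to 0.\<close>
  have "\<exists>d>0. d < eps n \<and> (\<forall>i\<in>{-1, 1}. \<forall>y\<in>UNIV.
      1 * (p d i 1 * f 1 (y + speed i * d) + p d i (-1) * f (-1) (y + speed i * d))
      \<le> 1 * (exp ((r + 1 * eps n) * d) * f i y))" for n
  proof -
    have "\<forall>\<^sub>F d in at_right 0. \<forall>i\<in>{-1, 1}. \<forall>y\<in>UNIV.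
      1 * (p d i 1 * f 1 (y + speed i * d) + p d i (-1) * f (-1) (y + speed i * d))
      \<le> 1 * (exp ((r + 1 * eps n) * d) * f i y)"
      by (rule step_condition[OF prof eps]) (use gen in auto)
    with eventually_at_right_real[OF eps[of n]]
    have "\<forall>\<^sub>F d in at_right 0. d > 0 \<and> d < eps n \<and> (\<forall>i\<in>{-1, 1}. \<forall>y\<in>UNIV.
      1 * (p d i 1 * f 1 (y + speed i * d) + p d i (-1) * f (-1) (y + speed i * d))
      \<le> 1 * (exp ((r + 1 * eps n) * d) * f i y))"
      by eventually_elim simp
    then show ?thesis using eventually_happens by fastforce
  qed
  then obtain d where d: "\<And>n. 0 < d n" "\<And>n. d n < eps n"
    and step: "\<And>n i y. i \<in> {-1, 1} \<Longrightarrow>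
      1 * (p (d n) i 1 * f 1 (y + speed i * d n) + p (d n) i (-1) * f (-1) (y + speed i * d n))
      \<le> 1 * (exp ((r + eps n) * d n) * f i y)"
    by (simp, metis)
  have d0: "d \<longlonglongrightarrow> 0"
    by (rule tendsto_sandwich[OF _ _ tendsto_const eps0]) (intro always_eventually allI less_imp_le d)+
  \<comment> \<open>The cap reaches at least time \<open>n\<close>, so every finite value of
    \<open>tau\<close> is eventually below it.\<close>
  define N where "N n = nat \<lceil>real n / d n\<rceil>" for n
  define Q where "Q n k w \<longleftrightarrow> tau w \<le> ennreal (real k * d n)" for n k w
  define \<kappa> where "\<kappa> n w = first_time (Q n) (N n) w" for n w
  define G where "G n w = discounted f (r + eps n) (d n) x (\<kappa> n w) w" for n w
  have "integrable (completion M) (G n) \<and> 1 * (\<integral>w. G n w \<partial>completion M) \<le> 1 * f s x" for n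
    unfolding G_def \<kappa>_def
  proof (rule stopped_euler_bound[where U="\<lambda>_. UNIV"])
    show "{w \<in> space M. Q n k w} \<in> sets (completed (real k * d n))" for k
      unfolding Q_def by (rule hitting_event[OF tau])
  qed (use d(1)[of n] cont step in \<open>auto intro: less_imp_le\<close>)
  then have G: "integrable (completion M) (G n)" "(\<integral>w. G n w \<partial>completion M) \<le> f s x" for n by auto
  have Gpos: "0 \<le> G n w" for n w
    using fpos by (auto simp: G_def discounted_def less_imp_le)
  have lim: "(\<lambda>n. ennreal (G n w)) \<longlonglongrightarrow> ?H w" if w: "w \<in> space M" and fin: "tau w \<noteq> \<infinity>" for w
  proof -
    define t where "t = enn2real (tau w)"
    have t: "0 \<le> t" "tau w = ennreal t" using fin by (auto simp: t_def top.not_eq_extremum)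
    have "\<forall>\<^sub>F n in sequentially. t \<le> real n"
      using filterlim_real_sequentially by (auto simp: filterlim_at_top)
    then have k: "\<forall>\<^sub>F n in sequentially. t \<le> real (\<kappa> n w) * d n \<and> real (\<kappa> n w) * d n \<le> t + d n"
    proof eventually_elim
      case (elim n)
      have "real n / d n \<le> real (N n)" unfolding N_def by linarith
      then have "t \<le> real (N n) * d n" using elim d(1)[of n] by (simp add: field_simps)
      then have "Q n (N n) w" using t by (simp add: Q_def ennreal_leI)
      then have "Q n (\<kappa> n w) w" using first_time_hit[of "Q n" "N n" w] by (auto simp: \<kappa>_def)
      then have "t \<le> real (\<kappa> n w) * d n" using t d(1)[of n] by (simp add: Q_def)
      moreover have "real (\<kappa> n w) * d n \<le> t + d n"
      proof (cases "\<kappa> n w")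
        case 0
        then show ?thesis using t d(1)[of n] by simp
      next
        case (Suc j)
        then have "\<not> Q n j w" using not_before_first_time[of j "Q n" "N n" w] by (simp add: \<kappa>_def)
        then have "real j * d n < t" using t d(1)[of n] by (simp add: Q_def)
        then show ?thesis using Suc by (simp add: algebra_simps)
      qed
      ultimately show ?case by simp
    qed
    note conv = euler_tendsto_log_price[OF w t(1) d0 d(1) k]
    have "isCont (f (\<xi> t w)) (log_price x t w)"
      using cont by (simp add: continuous_on_eq_continuous_at)
    then have "(\<lambda>n. f (\<xi> t w) (euler (d n) x (\<kappa> n w) w)) \<longlonglongrightarrow> f (\<xi> t w) (log_price x t w)"
      using conv(1) by (rule isCont_tendsto_compose)
    then have "(\<lambda>n. exp (- (r + eps n) * (real (\<kappa> n w) * d n)) * f (\<xi> t w) (euler (d n) x (\<kappa> n w) w))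
        \<longlonglongrightarrow> exp (- (r + 0) * t) * f (\<xi> t w) (log_price x t w)"
      by (intro tendsto_intros conv(3) eps0)
    moreover have "\<forall>\<^sub>F n in sequentially.
        exp (- (r + eps n) * (real (\<kappa> n w) * d n)) * f (\<xi> t w) (euler (d n) x (\<kappa> n w) w) = G n w"
      using conv(2) by eventually_elim (simp add: G_def discounted_def)
    ultimately have "(\<lambda>n. G n w) \<longlonglongrightarrow> exp (- r * t) * f (\<xi> t w) (log_price x t w)"
      using Lim_transform_eventually by fastforce
    then show ?thesis using fin by (auto simp: t_def intro!: tendsto_ennrealI)
  qed
  have "(\<integral>\<^sup>+w. ?H w \<partial>completion M) \<le> (\<integral>\<^sup>+w. liminf (\<lambda>n. ennreal (G n w)) \<partial>completion M)"
  proof (rule nn_integral_mono)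
    fix w assume "w \<in> space (completion M)"
    \<comment> \<open>Where \<open>tau\<close> is infinite the left side is 0, so convergence is
      needed only for finite \<open>tau\<close>.\<close>
    then show "?H w \<le> liminf (\<lambda>n. ennreal (G n w))"
      using lim_imp_Liminf[OF sequentially_bot lim[of w]] by (cases "tau w = \<infinity>") auto
  qed
  also have "\<dots> \<le> liminf (\<lambda>n. \<integral>\<^sup>+w. ennreal (G n w) \<partial>completion M)"
    using G(1) by (intro nn_integral_liminf) auto
  also have "\<dots> \<le> ennreal (f s x)"
  proof (rule Liminf_le)
    show "\<forall>\<^sub>F n in sequentially. (\<integral>\<^sup>+w. ennreal (G n w) \<partial>completion M) \<le> ennreal (f s x)"
      using G Gpos by (intro always_eventually allI) (simp add: nn_integral_eq_integral ennreal_leI)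
  qed simp
  finally show ?thesis .
qed

end


section \<open>Lower bound by nearly optimal stopping on a grid\<close>

lemma abs_exp_diff_le:
  fixes u v :: real
  assumes "u \<le> B" "v \<le> B"
  shows "\<bar>exp u - exp v\<bar> \<le> exp B * \<bar>u - v\<bar>"
proof -
  have *: "exp u - exp v \<le> exp B * (u - v)" if "v \<le> u" "u \<le> B" for u v :: real
  proof -
    have "exp u * (1 + (v - u)) \<le> exp u * exp (v - u)"
      by (intro mult_left_mono exp_ge_add_one_self) simp
    then have "exp u - exp v \<le> exp u * (u - v)"
      by (simp add: exp_diff algebra_simps)
    also have "\<dots> \<le> exp B * (u - v)" using that by (intro mult_right_mono) auto
    finally show ?thesis .
  qed
  show ?thesis
    using *[of v u] *[of u v] assms by (cases "v \<le> u") auto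
qed

lemma extended_expectation_integrable:
  assumes "integrable M X"
  shows "extended_expectation M X = ereal (\<integral>w. X w \<partial>M)"
proof -
  have fin: "(\<integral>\<^sup>+w. ennreal (X w) \<partial>M) < \<infinity>" "(\<integral>\<^sup>+w. ennreal (- X w) \<partial>M) < \<infinity>"
    using assms by (auto simp: real_integrable_def top.not_eq_extremum)
  show ?thesis
    unfolding extended_expectation_def real_lebesgue_integral_def[OF assms]
    using fin by (metis ennreal_enn2real enn2ereal_ennreal enn2real_nonneg infinity_ennreal_def ereal_minus(1))
qed

lemma measurable_first_time [measurable]:
  assumes [measurable]: "\<And>k. Measurable.pred M (Q k)"
  shows "first_time Q n \<in> measurable M (count_space UNIV)"
  unfolding first_time_def[abs_def]
  by (intro measurable_Least pred_intros_logic assms) simp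

context telegraph
begin

text \<open>The chain is stopped when it is in state \<open>-1\<close> and the Euler log price is at least \<open>z\<close>, at a
  grid time up to the horizon \<open>S\<close>. The profile \<open>W\<close> grows at a smaller rate than \<open>r\<close> and
  controls what is lost by giving up at the horizon.\<close>

lemma stopping_value_ge:
  assumes prof: "log_lipschitz_profile f f' z"
    and gen: "\<And>i y. i \<in> {-1, 1} \<Longrightarrow> y \<noteq> z \<Longrightarrow> i = 1 \<or> y < z \<Longrightarrow>
      (lam + r) * f i y - lam * f (- i) y \<le> speed i * f' i y"
    and stop: "\<And>y. z \<le> y \<Longrightarrow> f (-1) y = exp y - a" and "0 < a"
    and prof_W: "log_lipschitz_profile W W' zW"
    and gen_W: "\<And>i y. i \<in> {-1, 1} \<Longrightarrow> y \<noteq> zW \<Longrightarrow> speed i * W' i y \<le> (lam + q) * W i y - lam * W (- i) y"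
    and "q < r" and f_le_W: "\<And>i y. f i y \<le> C * W i y" and "0 < e"
  shows "\<exists>tau. stopping_time (completed_natural_filtration M \<xi>) tau \<and>
    ereal (f s x - e) \<le> extended_expectation (completion M) (\<lambda>w. reward mu sig a r \<xi> (exp x) (tau w) w)"
proof -
  have cont: "\<And>i. continuous_on UNIV (f i)" and fpos: "\<And>i y. 0 < f i y"
    using prof by (auto simp: log_lipschitz_profile_def)
  have cont_W: "\<And>i. continuous_on UNIV (W i)" and Wpos: "\<And>i y. 0 < W i y"
    using prof_W by (auto simp: log_lipschitz_profile_def)
  have "0 < C * W s x" using fpos[of s x] f_le_W[of s x] by linarith
  then have "0 < C" using Wpos[of s x] by (simp add: zero_less_mult_iff)
  have "((\<lambda>S. C * exp (- ((r - q) / 2) * S) * W s x) \<longlongrightarrow> 0) at_top"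
  proof -
    have "filterlim (\<lambda>S. - ((r - q) / 2) * S) at_bot at_top"
      using \<open>q < r\<close> by (intro filterlim_tendsto_neg_mult_at_bot[OF tendsto_const _ filterlim_ident]) simp
    from tendsto_mult[OF tendsto_mult[OF tendsto_const filterlim_compose[OF exp_at_bot this], of C] tendsto_const, of "W s x"]
    show ?thesis by simp
  qed
  then have "\<forall>\<^sub>F S in at_top. C * exp (- ((r - q) / 2) * S) * W s x < e / 2"
    using \<open>0 < e\<close> by (intro order_tendstoD) auto
  with eventually_gt_at_top[of "0::real"]
  have "\<forall>\<^sub>F S in at_top. 0 < S \<and> C * exp (- ((r - q) / 2) * S) * W s x < e / 2"
    by eventually_elim simp
  from eventually_happens[OF this]
  obtain S where S: "0 < S" "C * exp (- ((r - q) / 2) * S) * W s x < e / 2" by auto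
  \<comment> \<open>With \<open>eps n\<close> at most \<open>(r - q) / 4\<close>, the gap
    \<open>r - q - 2 * eps n\<close> between the perturbed rates is still at least
    \<open>(r - q) / 2\<close>, the decay rate used to choose \<open>S\<close>.\<close>
  define eps where "eps n = min ((r - q) / 4) (inverse (real (Suc n)))" for n
  have eps: "0 < eps n" "eps n \<le> (r - q) / 4" "eps n \<le> inverse (real (Suc n))" for n
    using \<open>q < r\<close> unfolding eps_def by (simp_all only: min.cobounded1 min.cobounded2) simp
  have "inverse (real (Suc n)) \<le> 1" for n by (simp add: field_simps)
  with eps(3) have eps1: "eps n \<le> 1" for n using order_trans by blast
  have eps0: "eps \<longlonglongrightarrow> 0"
    by (rule tendsto_sandwich[OF _ _ tendsto_const LIMSEQ_inverse_real_of_nat])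
      (intro always_eventually allI less_imp_le[OF eps(1)] eps(3))+
  \<comment> \<open>Before stopping, state -1 occurs only below \<open>z\<close>; its flow moves
    left, so this region is invariant and the subsolution inequality beyond \<open>z\<close> is
    never called for in state -1.\<close>
  define U where "U i = (if i = -1 then {..<z} else UNIV)" for i :: real
  have flow: "y + speed i * t \<in> U i" if "i \<in> {-1, 1}" "y \<in> U i" "0 \<le> t" for i y t
  proof (cases "i = -1")
    case True
    then have "speed i * t \<le> 0"
      using mu_less_sig that(3) by (simp add: speed_def mult_nonpos_nonneg)
    then show ?thesis using that True by (auto simp: U_def)
  qed (simp add: U_def)
  define stepf where "stepf d n \<longleftrightarrow> (\<forall>i\<in>{-1, 1}. \<forall>y\<in>U i.
      (-1) * (p d i 1 * f 1 (y + speed i * d) + p d i (-1) * f (-1) (y + speed i * d))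
      \<le> (-1) * (exp ((r + (-1) * eps n) * d) * f i y))" for d n
  define stepW where "stepW d n \<longleftrightarrow> (\<forall>i\<in>{-1, 1}. \<forall>y\<in>UNIV.
      1 * (p d i 1 * W 1 (y + speed i * d) + p d i (-1) * W (-1) (y + speed i * d))
      \<le> 1 * (exp ((q + 1 * eps n) * d) * W i y))" for d n
  have "\<exists>d>0. d < eps n \<and> stepf d n \<and> stepW d n" for n
  proof -
    have "\<forall>\<^sub>F d in at_right 0. stepf d n"
      unfolding stepf_def
    proof (rule step_condition[OF prof eps(1) _ flow])
      fix i y assume iy: "i \<in> {-1, 1 :: real}" "y \<in> U i" "y \<noteq> z"
      then have "(lam + r) * f i y - lam * f (- i) y \<le> speed i * f' i y"
        by (intro gen) (auto simp: U_def split: if_splits)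
      then show "(-1) * (speed i * f' i y) \<le> (-1) * ((lam + r) * f i y - lam * f (- i) y)" by simp
    qed simp
    moreover have "\<forall>\<^sub>F d in at_right 0. stepW d n"
      unfolding stepW_def
      by (rule step_condition[OF prof_W eps(1)]) (use gen_W in auto)
    ultimately have "\<forall>\<^sub>F d in at_right 0. d > 0 \<and> d < eps n \<and> stepf d n \<and> stepW d n"
      using eventually_at_right_real[OF eps(1)[of n]] by eventually_elim simp
    from eventually_happens[OF this] show ?thesis by auto
  qed
  then obtain d where d: "\<And>n. 0 < d n" "\<And>n. d n < eps n" "\<And>n. stepf (d n) n" "\<And>n. stepW (d n) n"
    by metis
  have d0: "d \<longlonglongrightarrow> 0"
    by (rule tendsto_sandwich[OF _ _ tendsto_const eps0]) (intro always_eventually allI less_imp_le d)+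
  define N where "N n = nat \<lceil>S / d n\<rceil>" for n
  have N: "S \<le> real (N n) * d n" "real (N n) * d n \<le> S + 1" for n
  proof -
    have "0 \<le> S / d n" using S(1) d(1)[of n] by simp
    then have "S / d n \<le> real (N n)" "real (N n) \<le> S / d n + 1" unfolding N_def by linarith+
    then show "S \<le> real (N n) * d n" "real (N n) * d n \<le> S + 1"
      using d(1)[of n] d(2)[of n] eps1[of n] by (auto simp: field_simps)
  qed
  define X where "X n k w = euler (d n) x k w" for n k w
  define Q where "Q n k w \<longleftrightarrow> \<xi> (real k * d n) w = -1 \<and> z \<le> X n k w" for n k w
  define \<kappa> where "\<kappa> n = first_time (Q n) (N n)" for n
  define T where "T n w = real (\<kappa> n w) * d n" for n w
  have Tb: "0 \<le> T n w" "T n w \<le> S + 1" for n w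
  proof -
    show "0 \<le> T n w" using d(1)[of n] by (simp add: T_def)
    have "T n w \<le> real (N n) * d n"
      unfolding T_def \<kappa>_def using d(1)[of n] first_time_le[of "Q n" "N n" w]
      by (intro mult_right_mono) auto
    then show "T n w \<le> S + 1" using N(2)[of n] by linarith
  qed
  have Qadapted: "{w \<in> space M. Q n k w} \<in> sets (completed (real k * d n))" for n k
  proof -
    let ?N = "natural (real k * d n)"
    have [measurable]: "\<xi> (real k * d n) \<in> borel_measurable ?N" "X n k \<in> borel_measurable ?N"
      unfolding X_def using d(1)[of n]
      by (auto intro!: measurable_natural measurable_euler intro: mult_right_mono)
    have "{w \<in> space ?N. Q n k w} \<in> sets ?N" unfolding Q_def by measurable
    then show ?thesis using natural_subset_completed by auto
  qed
  have Q_meas [measurable]: "Measurable.pred (completion M) (Q n k)" for n k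
    using Qadapted[of n k] completed_subset_completion by (auto simp: pred_def)
  have \<kappa>_meas [measurable]: "\<kappa> n \<in> measurable (completion M) (count_space UNIV)" for n
    unfolding \<kappa>_def by measurable
  \<comment> \<open>\<open>\<kappa> n w = N n\<close> may mean success at the horizon or none at
    all. Only success counts as stopping; otherwise \<open>tau\<close> is infinite and the reward
    0.\<close>
  define hit where "hit n w \<longleftrightarrow> Q n (\<kappa> n w) w" for n w
  have hit_meas [measurable]: "Measurable.pred (completion M) (hit n)" for n
    unfolding hit_def by measurable
  define tau where "tau n w = (if hit n w then ennreal (T n w) else \<infinity>)" for n w
  have tau: "stopping_time (completed_natural_filtration M \<xi>) (tau n)" for n
  proof (rule stopping_timeI)
    fix t :: ennreal
    show "Measurable.pred (completed_natural_filtration M \<xi> t) (\<lambda>w. tau n w \<le> t)"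
    proof (cases "t = \<infinity>")
      case False
      \<comment> \<open>A finite union over grid times up to \<open>t\<close> of adapted events,
        which gives the stopping time property.\<close>
      have eq: "tau n w \<le> t \<longleftrightarrow> (\<exists>k\<in>{k. k \<le> N n \<and> ennreal (real k * d n) \<le> t}. Q n k w)" for w
      proof
        assume "tau n w \<le> t"
        then have "hit n w" "ennreal (T n w) \<le> t" using False by (auto simp: tau_def top_unique split: if_splits)
        then show "\<exists>k\<in>{k. k \<le> N n \<and> ennreal (real k * d n) \<le> t}. Q n k w"
          using first_time_le[of "Q n" "N n" w]
          by (intro bexI[of _ "\<kappa> n w"]) (auto simp: hit_def T_def \<kappa>_def)
      next
        assume "\<exists>k\<in>{k. k \<le> N n \<and> ennreal (real k * d n) \<le> t}. Q n k w"
        then obtain k where k: "k \<le> N n" "ennreal (real k * d n) \<le> t" "Q n k w" by blast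
        then have le: "\<kappa> n w \<le> k" using not_before_first_time[of k "Q n" "N n" w] by (force simp: \<kappa>_def)
        then have "hit n w"
          using first_time_hit[of "Q n" "N n" w] k by (auto simp: hit_def \<kappa>_def)
        moreover have "ennreal (T n w) \<le> ennreal (real k * d n)"
          unfolding T_def using le d(1)[of n] by (intro ennreal_leI mult_right_mono) auto
        ultimately show "tau n w \<le> t" using k(2) by (simp add: tau_def)
      qed
      have "Measurable.pred (completed_natural_filtration M \<xi> t) (Q n k)" if "ennreal (real k * d n) \<le> t" for k
        using subsetD[OF completed_mono[OF that] Qadapted[of n k]] by (simp add: pred_def)
      then show ?thesis unfolding eq by (intro pred_intros_finite) auto
    qed simp
  qed
  define L where "L n w = log_price x (T n w) w" for n w
  \<comment> \<open>\<open>P\<close> is the payoff of the discretised problem, with the Euler price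
    and the rate \<open>r - eps n\<close> at which the profile is a discrete subsolution;
    \<open>R\<close> is the true reward at the same stopping time.\<close>
  define P where "P n w = (if hit n w then exp (- (r - eps n) * T n w) * (exp (X n (\<kappa> n w) w) - a) else 0)" for n w
  define R where "R n w = (if hit n w then exp (- r * T n w) * (exp (L n w) - a) else 0)" for n w
  have R_eq: "reward mu sig a r \<xi> (exp x) (tau n w) w = R n w" for n w
    using Tb(1) by (simp add: reward_def tau_def R_def L_def price_eq_exp)
  have X_meas [measurable]: "X n k \<in> borel_measurable (completion M)" for n k
    unfolding X_def using d(1)[of n] by (intro measurable_completion measurable_euler_M) simp
  have [measurable]: "(\<lambda>w. X n (\<kappa> n w) w) \<in> borel_measurable (completion M)" for n
    by (rule measurable_compose_countable[where f="\<lambda>k w. X n k w"]) measurable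
  have T_meas [measurable]: "T n \<in> borel_measurable (completion M)" for n
    unfolding T_def by measurable
  have log_price_meas: "log_price x (real k * d n) \<in> borel_measurable (completion M)" for n k
    using d(1)[of n] by (intro measurable_completion measurable_log_price) simp
  have [measurable]: "L n \<in> borel_measurable (completion M)" for n
    unfolding L_def[abs_def] T_def
    by (rule measurable_compose_countable[where f="\<lambda>k w. log_price x (real k * d n) w",
          OF log_price_meas \<kappa>_meas])
  have [measurable]: "P n \<in> borel_measurable (completion M)" "R n \<in> borel_measurable (completion M)" for n
    unfolding P_def R_def by measurable
  \<comment> \<open>A bound for all exponents up to time \<open>S + 1\<close>: the first summand
    covers both discount rates, as \<open>eps n \<le> 1\<close>, the second both log prices.\<close>
  define E where "E = (\<bar>r\<bar> + 1) * (S + 1) + (\<bar>x\<bar> + (mu + sig) * (S + 1))"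
  have X_le: "\<bar>X n (\<kappa> n w) w\<bar> \<le> \<bar>x\<bar> + (mu + sig) * (S + 1)" if "w \<in> space M" for n w
  proof -
    have "\<bar>X n (\<kappa> n w) w - x\<bar> \<le> T n w * (mu + sig)"
      unfolding X_def T_def using that d(1)[of n] by (intro euler_bound) auto
    also have "\<dots> \<le> (S + 1) * (mu + sig)"
      using Tb[of n w] mu_pos mu_less_sig by (intro mult_right_mono) auto
    finally show ?thesis by (simp add: mult.commute)
  qed
  have L_le: "\<bar>L n w\<bar> \<le> \<bar>x\<bar> + (mu + sig) * (S + 1)" if "w \<in> space M" for n w
  proof -
    have "\<bar>log_price x (T n w) w - log_price x 0 w\<bar> \<le> (mu + sig) * (T n w - 0)"
      using that Tb by (intro log_price_increment) auto
    also have "\<dots> \<le> (mu + sig) * (S + 1)"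
      using Tb[of n w] mu_pos mu_less_sig by (intro mult_left_mono) auto
    finally show ?thesis by (simp add: L_def log_price_def)
  qed
  have rate_le: "- (r - eps n) * T n w \<le> (\<bar>r\<bar> + 1) * (S + 1)" "- r * T n w \<le> (\<bar>r\<bar> + 1) * (S + 1)" for n w
  proof -
    have "c * T n w \<le> (\<bar>r\<bar> + 1) * (S + 1)" if "c \<le> \<bar>r\<bar> + 1" for c
    proof -
      have "c * T n w \<le> (\<bar>r\<bar> + 1) * T n w" using that Tb(1) by (rule mult_right_mono)
      also have "\<dots> \<le> (\<bar>r\<bar> + 1) * (S + 1)" using Tb(2) by (intro mult_left_mono) auto
      finally show ?thesis .
    qed
    then show "- (r - eps n) * T n w \<le> (\<bar>r\<bar> + 1) * (S + 1)" "- r * T n w \<le> (\<bar>r\<bar> + 1) * (S + 1)"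
      using eps1[of n] by (intro \<open>\<And>c. c \<le> \<bar>r\<bar> + 1 \<Longrightarrow> c * T n w \<le> (\<bar>r\<bar> + 1) * (S + 1)\<close>; linarith)+
  qed
  have "0 \<le> \<bar>x\<bar> + (mu + sig) * (S + 1)" using mu_pos mu_less_sig S(1) by simp
  then have rate_le_E: "- (r - eps n) * T n w \<le> E" "- r * T n w \<le> E" for n w
    using rate_le[of n w] by (auto simp: E_def)
  have exps: "- (r - eps n) * T n w + X n (\<kappa> n w) w \<le> E" "- r * T n w + L n w \<le> E" if "w \<in> space M" for n w
    using rate_le[of n w] X_le[OF that, of n] L_le[OF that, of n] by (auto simp: E_def)
  have P_eq: "P n w = (if hit n w then exp (- (r - eps n) * T n w + X n (\<kappa> n w) w) - a * exp (- (r - eps n) * T n w) else 0)"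
    and R_eq': "R n w = (if hit n w then exp (- r * T n w + L n w) - a * exp (- r * T n w) else 0)" for n w
    unfolding P_def R_def exp_add by (simp_all only: right_diff_distrib mult.commute[of a])
  have diff_bound: "\<bar>u - a * v\<bar> \<le> exp E + a * exp E" if "0 < u" "u \<le> exp E" "0 < v" "v \<le> exp E" for u v
  proof -
    have "0 \<le> a * v" "a * v \<le> a * exp E" using that \<open>0 < a\<close> by auto
    then show ?thesis using that by (auto simp: abs_le_iff)
  qed
  have PR_bound: "\<bar>P n w\<bar> \<le> exp E + a * exp E" "\<bar>R n w\<bar> \<le> exp E + a * exp E" if "w \<in> space M" for n w
    unfolding P_eq R_eq' using exps[OF that, of n] rate_le_E[of n w] \<open>0 < a\<close>
    by (auto intro!: diff_bound exp_gt_zero)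
  have intP: "integrable (completion M) (P n)" and intR: "integrable (completion M) (R n)" for n
    using PR_bound by (auto intro!: completion.integrable_const_bound[where B="exp E + a * exp E"] AE_I2)
  \<comment> \<open>The bounded horizon dominates both payoffs by a constant. The limit makes their
    difference smaller than \<open>e / 2\<close>; the other half of \<open>e\<close> is left for the
    tail.\<close>
  have "(\<lambda>n. \<integral>w. P n w - R n w \<partial>completion M) \<longlonglongrightarrow> (\<integral>w. 0 \<partial>completion M)"
  proof (rule integral_dominated_convergence[where w="\<lambda>_. 2 * (exp E + a * exp E)"])
    show "AE w in completion M. norm (P n w - R n w) \<le> 2 * (exp E + a * exp E)" for n
    proof (rule AE_I2)
      fix w assume "w \<in> space (completion M)"
      then show "norm (P n w - R n w) \<le> 2 * (exp E + a * exp E)"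
        using PR_bound[of w n] by (simp add: abs_le_iff)
    qed
    show "AE w in completion M. (\<lambda>n. P n w - R n w) \<longlonglongrightarrow> 0"
    proof (rule AE_I2)
      fix w assume "w \<in> space (completion M)"
      then have w: "w \<in> space M" by simp
      obtain J where J: "\<And>d k. 0 < d \<Longrightarrow> real k * d \<le> S + 1 \<Longrightarrow> \<bar>euler d x k w - log_price x (real k * d) w\<bar> \<le> J * d"
        using euler_error[OF w, where S="S + 1" and x=x] by metis
      show "(\<lambda>n. P n w - R n w) \<longlonglongrightarrow> 0"
      proof (rule Lim_null_comparison)
        show "\<forall>\<^sub>F n in sequentially. norm (P n w - R n w)
          \<le> exp E * (J * d n + eps n * (S + 1)) + a * (exp E * (eps n * (S + 1)))"
        proof (intro always_eventually allI)
          fix n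
          have eT: "\<bar>- (r - eps n) * T n w - - r * T n w\<bar> \<le> eps n * (S + 1)"
          proof -
            have "- (r - eps n) * T n w - - r * T n w = eps n * T n w" by (simp add: algebra_simps)
            moreover have "eps n * T n w \<le> eps n * (S + 1)"
              using Tb[of n w] eps(1)[of n] by (intro mult_left_mono) auto
            moreover have "0 \<le> eps n * T n w" using Tb(1) eps(1)[of n] by (simp add: less_imp_le)
            ultimately show ?thesis by simp
          qed
          have XL: "\<bar>X n (\<kappa> n w) w - L n w\<bar> \<le> J * d n"
            unfolding X_def L_def T_def using Tb(2)[of n w] d(1)[of n] by (intro J) (auto simp: T_def)
          have "\<bar>exp (- (r - eps n) * T n w + X n (\<kappa> n w) w) - exp (- r * T n w + L n w)\<bar>
              \<le> exp E * \<bar>(- (r - eps n) * T n w + X n (\<kappa> n w) w) - (- r * T n w + L n w)\<bar>"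
            by (intro abs_exp_diff_le exps w)
          also have "\<dots> \<le> exp E * (J * d n + eps n * (S + 1))"
            using eT XL by (intro mult_left_mono) auto
          finally have 1: "\<bar>exp (- (r - eps n) * T n w + X n (\<kappa> n w) w) - exp (- r * T n w + L n w)\<bar>
              \<le> exp E * (J * d n + eps n * (S + 1))" .
          have "\<bar>exp (- (r - eps n) * T n w) - exp (- r * T n w)\<bar>
              \<le> exp E * \<bar>- (r - eps n) * T n w - - r * T n w\<bar>"
            by (intro abs_exp_diff_le rate_le_E)
          also have "\<dots> \<le> exp E * (eps n * (S + 1))"
            using eT by (intro mult_left_mono) auto
          finally have "\<bar>exp (- (r - eps n) * T n w) - exp (- r * T n w)\<bar> \<le> exp E * (eps n * (S + 1))" .
          then have "a * \<bar>exp (- (r - eps n) * T n w) - exp (- r * T n w)\<bar> \<le> a * (exp E * (eps n * (S + 1)))"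
            using \<open>0 < a\<close> by (intro mult_left_mono) auto
          then have 2: "\<bar>a * exp (- (r - eps n) * T n w) - a * exp (- r * T n w)\<bar> \<le> a * (exp E * (eps n * (S + 1)))"
            using \<open>0 < a\<close> by (simp add: abs_mult flip: right_diff_distrib)
          show "norm (P n w - R n w) \<le> exp E * (J * d n + eps n * (S + 1)) + a * (exp E * (eps n * (S + 1)))"
          proof (cases "hit n w")
            case True
            then show ?thesis unfolding P_eq R_eq' using 1 2 by (simp add: abs_le_iff)
          next
            case False
            then show ?thesis unfolding P_eq R_eq' using 1 2 by (simp add: abs_le_iff)
          qed
        qed
        have "(\<lambda>n. exp E * (J * d n + eps n * (S + 1)) + a * (exp E * (eps n * (S + 1))))
          \<longlonglongrightarrow> exp E * (J * 0 + 0 * (S + 1)) + a * (exp E * (0 * (S + 1)))"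
          by (intro tendsto_intros d0 eps0)
        then show "(\<lambda>n. exp E * (J * d n + eps n * (S + 1)) + a * (exp E * (eps n * (S + 1)))) \<longlonglongrightarrow> 0"
          by simp
      qed
    qed
  qed (auto simp: prob_space)
  then have "(\<lambda>n. \<integral>w. P n w - R n w \<partial>completion M) \<longlonglongrightarrow> 0" by simp
  then have "\<forall>\<^sub>F n in sequentially. (\<integral>w. P n w - R n w \<partial>completion M) < e / 2"
    using \<open>0 < e\<close> by (intro order_tendstoD) auto
  from eventually_happens[OF this]
  obtain n where n: "(\<integral>w. P n w - R n w \<partial>completion M) < e / 2" by auto
  have stopped: "integrable (completion M) (\<lambda>w. discounted f (r - eps n) (d n) x (\<kappa> n w) w)"
      "f s x \<le> (\<integral>w. discounted f (r - eps n) (d n) x (\<kappa> n w) w \<partial>completion M)"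
  proof -
    have "integrable (completion M) (\<lambda>w. discounted f (r - eps n) (d n) x (\<kappa> n w) w) \<and>
      (-1) * (\<integral>w. discounted f (r - eps n) (d n) x (\<kappa> n w) w \<partial>completion M) \<le> (-1) * f s x"
      unfolding \<kappa>_def
    proof (rule stopped_euler_bound[where U=U, OF less_imp_le[OF d(1)] _ cont Qadapted])
      show "euler (d n) x k w \<in> U (\<xi> (real k * d n) w)" if "w \<in> space M" "\<not> Q n k w" for w k
        using that by (auto simp: U_def Q_def X_def)
    qed (use d(3)[of n] in \<open>auto simp: stepf_def\<close>)
    then show "integrable (completion M) (\<lambda>w. discounted f (r - eps n) (d n) x (\<kappa> n w) w)"
      "f s x \<le> (\<integral>w. discounted f (r - eps n) (d n) x (\<kappa> n w) w \<partial>completion M)" by auto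
  qed
  have tail: "integrable (completion M) (discounted W (q + eps n) (d n) x (N n))"
      "(\<integral>w. discounted W (q + eps n) (d n) x (N n) w \<partial>completion M) \<le> W s x"
  proof -
    \<comment> \<open>With the predicate that never holds, \<open>first_time\<close> is the
      deterministic index \<open>N n\<close>.\<close>
    have "integrable (completion M) (\<lambda>w. discounted W (q + eps n) (d n) x (first_time (\<lambda>_ _. False) (N n) w) w) \<and>
      1 * (\<integral>w. discounted W (q + eps n) (d n) x (first_time (\<lambda>_ _. False) (N n) w) w \<partial>completion M) \<le> 1 * W s x"
      by (rule stopped_euler_bound[where U="\<lambda>_. UNIV", OF less_imp_le[OF d(1)] _ cont_W])
        (use d(4)[of n] in \<open>auto simp: stepW_def\<close>)
    then show "integrable (completion M) (discounted W (q + eps n) (d n) x (N n))"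
      "(\<integral>w. discounted W (q + eps n) (d n) x (N n) w \<partial>completion M) \<le> W s x"
      by (simp_all add: first_time_eq_bound)
  qed
  \<comment> \<open>At the horizon \<open>r - eps n\<close> is split as
    \<open>(r - q - 2 * eps n) + (q + eps n)\<close>; the first part produces \<open>c\<close>, the
    second is the discount of \<open>W\<close>.\<close>
  define c where "c = C * exp (- ((r - q) / 2) * S)"
  have "0 < c" using \<open>0 < C\<close> by (simp add: c_def)
  have pw: "discounted f (r - eps n) (d n) x (\<kappa> n w) w \<le> P n w + c * discounted W (q + eps n) (d n) x (N n) w"
    if w: "w \<in> space M" for w
  proof (cases "hit n w")
    case True
    then have "discounted f (r - eps n) (d n) x (\<kappa> n w) w = P n w"
      using stop by (simp add: P_def discounted_def hit_def Q_def X_def T_def)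
    moreover have "0 \<le> c * discounted W (q + eps n) (d n) x (N n) w"
      using \<open>0 < c\<close> Wpos by (simp add: discounted_def less_imp_le)
    ultimately show ?thesis by simp
  next
    case False
    then have N\<kappa>: "\<kappa> n w = N n"
      using first_time_hit[of "Q n" "N n" w] by (auto simp: hit_def \<kappa>_def)
    let ?t = "real (N n) * d n" and ?W = "W (\<xi> (real (N n) * d n) w) (euler (d n) x (N n) w)"
    have "discounted f (r - eps n) (d n) x (\<kappa> n w) w
        \<le> exp (- (r - eps n) * ?t) * (C * ?W)"
      unfolding discounted_def N\<kappa> by (intro mult_left_mono f_le_W) simp
    also have "exp (- (r - eps n) * ?t) = exp (- (r - q - 2 * eps n) * ?t) * exp (- (q + eps n) * ?t)"
      by (simp add: algebra_simps flip: exp_add)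
    also have "\<dots> * (C * ?W) = exp (- (r - q - 2 * eps n) * ?t) * (C * (exp (- (q + eps n) * ?t) * ?W))"
      by simp
    also have "\<dots> \<le> exp (- ((r - q) / 2) * S) * (C * (exp (- (q + eps n) * ?t) * ?W))"
    proof (intro mult_right_mono)
      have "(r - q) / 2 * S \<le> (r - q - 2 * eps n) * ?t"
        using eps(2)[of n] N(1)[of n] S(1) \<open>q < r\<close> by (intro mult_mono) auto
      then show "exp (- (r - q - 2 * eps n) * ?t) \<le> exp (- ((r - q) / 2) * S)"
        by (simp only: exp_le_cancel_iff mult_minus_left neg_le_iff_le)
    qed (use \<open>0 < C\<close> Wpos in \<open>simp add: less_imp_le\<close>)
    finally show ?thesis
      using False by (simp add: P_def c_def discounted_def ac_simps)
  qed
  have "f s x \<le> (\<integral>w. discounted f (r - eps n) (d n) x (\<kappa> n w) w \<partial>completion M)"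
    by (rule stopped(2))
  also have "\<dots> \<le> (\<integral>w. P n w + c * discounted W (q + eps n) (d n) x (N n) w \<partial>completion M)"
    using pw by (intro integral_mono stopped(1) Bochner_Integration.integrable_add intP integrable_mult_right tail(1)) auto
  also have "\<dots> = (\<integral>w. P n w \<partial>completion M) + c * (\<integral>w. discounted W (q + eps n) (d n) x (N n) w \<partial>completion M)"
    using intP tail(1) by simp
  also have "c * (\<integral>w. discounted W (q + eps n) (d n) x (N n) w \<partial>completion M) \<le> c * W s x"
    using \<open>0 < c\<close> tail(2) by (intro mult_left_mono) auto
  also have "c * W s x \<le> e / 2" using S(2) by (simp add: c_def)
  finally have "f s x - e / 2 \<le> (\<integral>w. P n w \<partial>completion M)" by simp
  also have "(\<integral>w. P n w \<partial>completion M) = (\<integral>w. P n w - R n w \<partial>completion M) + (\<integral>w. R n w \<partial>completion M)"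
    using intP intR by simp
  finally have "f s x - e \<le> (\<integral>w. R n w \<partial>completion M)" using n by simp
  then show ?thesis
    using tau[of n] by (intro exI[of _ "tau n"]) (simp add: R_eq extended_expectation_integrable[OF intR])
qed

end


section \<open>The explicit solution\<close>

locale stopping_regime =
  fixes lam mu sig a rho :: real
  assumes lam: "lam > 0" and mu: "mu > 0" and sig: "sig > 0" and a: "a > 0" and rho: "rho > 0"
    and rho_gt: "rho > mu - lam + sqrt (sig\<^sup>2 + lam\<^sup>2)"
    and rho_le: "rho \<le> mu + sig"
    and mu_less_sig: "mu < sig"
begin

section \<open>The constants and their algebraic relations\<close>

definition "b = b_const lam mu sig rho"
definition "Om = Omega_minus lam mu sig rho"
definition "om = omega_minus lam mu sig rho"
definition "u = a * ((1 - lam / (lam + rho) * om) / (1 - b * om))"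
definition "C = (u - a) / (om * u powr Om)"

abbreviation "D \<equiv> lam + rho"
abbreviation "p \<equiv> mu + sig"
abbreviation "q \<equiv> sig - mu"

lemma sqrt_gap: "sqrt (sig\<^sup>2 + lam\<^sup>2) < D - mu"
  using rho_gt by simp

lemma D_gt_p: "0 < D - p"
proof -
  have "sig \<le> sqrt (sig\<^sup>2 + lam\<^sup>2)" by (rule real_le_rsqrt) simp
  then show ?thesis using sqrt_gap by linarith
qed

text \<open>The growth assumption, squared: the characteristic expression
  \<open>(D - p * X) * (D + q * X)\<close> exceeds \<open>lam\<^sup>2\<close> at
  \<open>X = 1\<close>. Both \<open>Om_gt_1\<close> and the inequality beyond the threshold rest on
  it.\<close>

lemma gap: "lam\<^sup>2 < (D - p) * (D + q)"
proof -
  have "(sqrt (sig\<^sup>2 + lam\<^sup>2))\<^sup>2 < (D - mu)\<^sup>2"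
    by (rule power_strict_mono[OF sqrt_gap]) auto
  then have "sig\<^sup>2 + lam\<^sup>2 < (D - mu)\<^sup>2" by simp
  then show ?thesis by (simp add: power2_eq_square algebra_simps)
qed

text \<open>\<open>Om\<close> is an exponent for which \<open>(om, 1) * exp (Om * x)\<close> solves
  the homogeneous system. Since \<open>mu\<^sup>2 - sig\<^sup>2\<close> is negative, the minus sign
  before the root selects the larger solution, and \<open>gap\<close> places it to the right of
  1.\<close>

lemma Om_gt_1: "1 < Om" and Om_eq: "(D - p * Om) * (D + q * Om) = lam\<^sup>2"
proof -
  define s where "s = sqrt (lam\<^sup>2 * mu\<^sup>2 + sig\<^sup>2 * (rho\<^sup>2 + 2 * lam * rho))"
  have s2: "s\<^sup>2 = lam\<^sup>2 * mu\<^sup>2 + sig\<^sup>2 * (rho\<^sup>2 + 2 * lam * rho)" and s0: "0 \<le> s"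
    using lam mu sig rho by (simp_all add: s_def)
  have pq: "0 < p * q" using mu sig mu_less_sig by simp
  have denom: "mu\<^sup>2 - sig\<^sup>2 = - (p * q)" by (simp add: power2_eq_square algebra_simps)
  have "Om = (D * mu - s) / - (p * q)"
    unfolding Om_def Omega_minus_def s_def denom ..
  then have "Om * - (p * q) = D * mu - s"
    using pq by (metis less_irrefl neg_equal_0_iff_equal nonzero_divide_eq_eq)
  then have s_eq: "s = D * mu + p * q * Om" by (simp add: algebra_simps)
  have "p * q * (p * q * Om\<^sup>2 + 2 * mu * D * Om) = s\<^sup>2 - D\<^sup>2 * mu\<^sup>2"
    unfolding s_eq by (simp add: power2_eq_square algebra_simps)
  also have "\<dots> = p * q * (D\<^sup>2 - lam\<^sup>2)"
    unfolding s2 by (simp add: power2_eq_square algebra_simps)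
  finally have quad: "p * q * Om\<^sup>2 + 2 * mu * D * Om = D\<^sup>2 - lam\<^sup>2"
    using mu sig mu_less_sig by auto
  then show "(D - p * Om) * (D + q * Om) = lam\<^sup>2"
    by (simp add: power2_eq_square algebra_simps)
  have at_1: "p * q + 2 * mu * D < p * q * Om\<^sup>2 + 2 * mu * D * Om"
    unfolding quad using gap by (simp add: power2_eq_square algebra_simps)
  show "1 < Om"
  proof (rule ccontr)
    assume "\<not> 1 < Om"
    \<comment> \<open>The choice of the root enters here, through \<open>s \<ge> 0\<close>; the
      smaller root would have \<open>- s\<close> instead.\<close>
    moreover have "0 \<le> p * q * (1 + Om) + 2 * mu * D"
    proof -
      have "p * q * (1 + Om) + 2 * mu * D = s + p * q + D * mu"
        unfolding s_eq by (simp add: algebra_simps)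
      also have "0 \<le> \<dots>" using s0 pq lam rho mu by (intro add_nonneg_nonneg) auto
      finally show ?thesis .
    qed
    ultimately have "0 \<le> (1 - Om) * (p * q * (1 + Om) + 2 * mu * D)" by simp
    also have "\<dots> = (p * q + 2 * mu * D) - (p * q * Om\<^sup>2 + 2 * mu * D * Om)"
      by (simp add: power2_eq_square algebra_simps)
    finally show False using at_1 by simp
  qed
qed

text \<open>The differential equation of state +1 for the power solution; \<open>om_eq\<close> is
  the one of state -1.\<close>

lemma lam_om: "lam * om = D - p * Om"
  using lam by (simp add: om_def omega_minus_def Om_def[symmetric] field_simps)

lemma om_eq: "om * (D + q * Om) = lam"
proof -
  have "lam * (om * (D + q * Om)) = lam * lam"
    using Om_eq unfolding lam_om[symmetric] by (simp add: power2_eq_square)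
  then show ?thesis using lam by simp
qed

lemma om_pos: "0 < om"
proof -
  have "0 < D + q * Om" using lam rho Om_gt_1 mu_less_sig by (simp add: add_pos_pos)
  then show ?thesis using om_eq lam by (metis zero_less_mult_pos2)
qed

lemma p_less: "p < p * Om"
  using Om_gt_1 mu sig by simp

lemma om_less_1: "om < 1"
proof -
  have "lam * om < lam * 1" unfolding lam_om using p_less rho_le by simp
  then show ?thesis using lam by simp
qed

lemma b_eq: "b = lam / (D - p)"
  by (simp add: b_def b_const_def algebra_simps)

text \<open>Given \<open>D > p\<close>, this is the assumption \<open>rho \<le> mu + sig\<close>:
  waiting in state +1 for the switch does not lose against discounting.\<close>

lemma b_ge_1: "1 \<le> b"
  unfolding b_eq using D_gt_p rho_le by (simp add: field_simps)

lemma b_mult: "b * (D - p) = lam"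
  unfolding b_eq using D_gt_p by simp

lemma b_om: "1 - b * om = p * (Om - 1) / (D - p)"
  unfolding b_eq using D_gt_p lam_om by (simp add: field_simps)

lemma b_om_less: "0 < 1 - b * om"
  unfolding b_om using D_gt_p Om_gt_1 mu sig by simp

lemma u_eq: "u = a * Om * (D - p) / (D * (Om - 1))"
proof -
  have "1 - lam / D * om = p * Om / D"
    using lam rho lam_om by (simp add: field_simps)
  moreover have "a * ((P * Om / E) / (P * G / F)) = a * Om * F / (E * G)"
    if "P \<noteq> 0" for P E F G :: real
    using that by simp
  ultimately show ?thesis unfolding u_def b_om using mu sig by simp
qed

lemma u_minus_a: "u - a = a * (D - p * Om) / (D * (Om - 1))"
proof -
  have "D * (Om - 1) \<noteq> 0" using Om_gt_1 lam rho by simp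
  then have "u - a = (a * Om * (D - p) - a * (D * (Om - 1))) / (D * (Om - 1))"
    unfolding u_eq diff_divide_distrib by simp
  also have "a * Om * (D - p) - a * (D * (Om - 1)) = a * (D - p * Om)"
    by (simp add: algebra_simps)
  finally show ?thesis .
qed

lemma u_gt_a: "a < u"
proof -
  have "0 < D - p * Om" using lam_om om_pos lam by (metis mult_pos_pos)
  then have "0 < u - a" unfolding u_minus_a using a lam rho Om_gt_1 by simp
  then show ?thesis by simp
qed

lemma u_pos: "0 < u"
  using u_gt_a a by simp

text \<open>In the variable \<open>x\<close>, the left slope of the -1 branch at the threshold is
  \<open>(u - a) * Om\<close> and the right slope is \<open>u\<close>. The strict jump comes from
  \<open>D - p * Om < D - p\<close>.\<close>

lemma kink: "(u - a) * Om < u"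
proof -
  have "(D - p * Om) * (a * Om / (D * (Om - 1))) < (D - p) * (a * Om / (D * (Om - 1)))"
    using p_less a lam rho Om_gt_1 by (intro mult_strict_right_mono) auto
  then show ?thesis unfolding u_minus_a unfolding u_eq by (simp add: ac_simps)
qed

text \<open>This equation determines \<open>u\<close>: \<open>C\<close> is fixed by continuity in
  state -1, and the same \<open>C\<close> must make state +1 continuous.\<close>

lemma u_match: "u - a = om * (b * u - a * (lam / D))"
proof -
  have "u * (1 - b * om) = a * (1 - lam / D * om)"
    unfolding u_def using b_om_less by simp
  then show ?thesis by (simp add: algebra_simps)
qed

lemma C_pos: "0 < C"
  unfolding C_def using u_gt_a om_pos u_pos by simp

section \<open>The candidate value in the log price\<close>

abbreviation "z \<equiv> ln u"

lemma exp_z: "exp z = u" using u_pos by simp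

lemma C_exp: "C * om * exp (Om * z) = u - a" "C * exp (Om * z) = b * u - a * (lam / D)"
proof -
  have "u powr Om = exp (Om * z)" using u_pos by (simp add: powr_def)
  then have C: "C = (u - a) / (om * exp (Om * z))" by (simp add: C_def)
  show "C * om * exp (Om * z) = u - a" unfolding C using om_pos by simp
  show "C * exp (Om * z) = b * u - a * (lam / D)" unfolding C u_match using om_pos by simp
qed

text \<open>With \<open>t\<close> exponentially distributed of rate \<open>lam\<close>,
  \<open>b * y - a * (lam / D)\<close> is the mean of
  \<open>exp (- rho * t) * (y * exp (p * t) - a)\<close>, the reward for stopping at the first
  switch. Every \<open>i\<close> other than 1 is treated as state -1, so that the profile conditions
  hold for all real \<open>i\<close>.\<close>

definition V :: "real \<Rightarrow> real \<Rightarrow> real" where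
  "V i x = (if i = 1 then if x \<le> z then C * exp (Om * x) else b * exp x - a * (lam / D)
            else if x \<le> z then C * om * exp (Om * x) else exp x - a)"

definition V' :: "real \<Rightarrow> real \<Rightarrow> real" where
  "V' i x = (if i = 1 then if x \<le> z then C * (Om * exp (Om * x)) else b * exp x
            else if x \<le> z then C * om * (Om * exp (Om * x)) else exp x)"

lemma V_deriv: "(V i has_real_derivative V' i x) (at x)" if "x \<noteq> z"
proof (cases "x < z")
  case True
  define g where "g y = (if i = 1 then C else C * om) * exp (Om * y)" for y
  have "(g has_real_derivative V' i x) (at x)"
    unfolding g_def using True by (auto intro!: derivative_eq_intros simp: V'_def)
  then show ?thesis
    by (rule has_field_derivative_transform_within_open[where S="{..<z}"])
      (use True in \<open>auto simp: g_def V_def\<close>)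
next
  case False
  with that have x: "z < x" by simp
  define g where "g y = (if i = 1 then b * exp y - a * (lam / D) else exp y - a)" for y
  have "(g has_real_derivative V' i x) (at x)"
    unfolding g_def using x by (cases "i = 1") (auto intro!: derivative_eq_intros simp: V'_def)
  then show ?thesis
    by (rule has_field_derivative_transform_within_open[where S="{z<..}"])
      (use x in \<open>auto simp: g_def V_def\<close>)
qed

lemma V_cont: "continuous_on UNIV (V i)"
proof -
  have "continuous_on UNIV (\<lambda>x. if x \<le> z then (if i = 1 then C else C * om) * exp (Om * x)
      else if i = 1 then b * exp x - a * (lam / D) else exp x - a)"
    using C_exp exp_z
    by (intro continuous_on_cases_le; cases "i = 1") (auto intro!: continuous_intros)
  also have "(\<lambda>x. if x \<le> z then (if i = 1 then C else C * om) * exp (Om * x)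
      else if i = 1 then b * exp x - a * (lam / D) else exp x - a) = V i"
    by (auto simp: V_def fun_eq_iff)
  finally show ?thesis .
qed

lemma lam_D: "lam / D < 1" using lam rho by simp

lemma exp_gt_u: "z < x \<Longrightarrow> u < exp x"
  using exp_z by (metis exp_less_mono)

lemma upper_branch: "z < x \<Longrightarrow> b * (exp x - a) \<le> b * exp x - a * (lam / D)"
proof -
  have "a * (lam / D) \<le> a * b"
    using lam_D b_ge_1 a by (intro mult_left_mono) linarith+
  then show ?thesis by (simp add: algebra_simps)
qed

lemma V_pos: "0 < V i x"
proof (cases "x \<le> z")
  case True
  then show ?thesis using C_pos om_pos by (simp add: V_def)
next
  case False
  then have "0 < exp x - a" using exp_gt_u[of x] u_gt_a by simp
  moreover have "0 < b * (exp x - a)" using \<open>0 < exp x - a\<close> b_ge_1 by simp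
  ultimately show ?thesis using upper_branch[of x] False by (auto simp: V_def)
qed

text \<open>Since \<open>u > a\<close>, the payoff beyond \<open>z\<close> is a fixed fraction of
  the price; this bounds the logarithmic derivative of both right branches.\<close>

lemma exp_le_shift: "exp x \<le> u / (u - a) * (exp x - a)" if "z < x"
proof -
  have "a * u \<le> a * exp x" using exp_gt_u[OF that] a by simp
  then show ?thesis using u_gt_a by (simp add: field_simps)
qed

lemma V_mono_state: "V (-1) x \<le> V 1 x"
proof (cases "x \<le> z")
  case True
  then show ?thesis using C_pos om_less_1 by (simp add: V_def mult_le_cancel_left1)
next
  case False
  then have "1 * (exp x - a) \<le> b * (exp x - a)"
    using exp_gt_u[of x] u_gt_a b_ge_1 by (intro mult_right_mono) auto
  then show ?thesis using upper_branch[of x] False by (auto simp: V_def)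
qed

lemma V_profile: "log_lipschitz_profile V V' z"
proof -
  \<comment> \<open>\<open>Om\<close> is the logarithmic slope left of \<open>z\<close>, and
    \<open>u / (u - a)\<close> bounds it on the right.\<close>
  define K where "K = Om + u / (u - a)"
  have K: "0 \<le> K" "Om \<le> K" "u / (u - a) \<le> K"
    using Om_gt_1 u_gt_a u_pos by (auto simp: K_def)
  have bound: "\<bar>V' i x\<bar> \<le> K * V i x" if "x \<noteq> z" for i x
  proof (cases "x \<le> z")
    case True
    then have "V' i x = Om * V i x" by (auto simp: V_def V'_def)
    then show ?thesis using K(2) V_pos[of i x] Om_gt_1 by (simp add: abs_mult mult_right_mono)
  next
    case False
    then have x: "z < x" by simp
    have ex: "exp x \<le> u / (u - a) * (exp x - a)" by (rule exp_le_shift[OF x])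
    have "\<bar>V' i x\<bar> \<le> u / (u - a) * V i x"
    proof (cases "i = 1")
      case True
      have "b * exp x \<le> b * (u / (u - a) * (exp x - a))"
        using ex b_ge_1 by (intro mult_left_mono) auto
      also have "\<dots> = u / (u - a) * (b * (exp x - a))" by simp
      also have "\<dots> \<le> u / (u - a) * (b * exp x - a * (lam / D))"
        using u_gt_a u_pos by (intro mult_left_mono upper_branch x) auto
      finally show ?thesis using True x b_ge_1 by (simp add: V_def V'_def)
    next
      case False
      then show ?thesis using ex x by (simp add: V_def V'_def)
    qed
    also have "\<dots> \<le> K * V i x" using K(3) V_pos[of i x] by (intro mult_right_mono) auto
    finally show ?thesis .
  qed
  \<comment> \<open>\<open>1 / om\<close> is the ratio of the states left of \<open>z\<close>,
    \<open>b * (u / (u - a))\<close> bounds it on the right, and 1 serves the opposite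
    ratio.\<close>
  define R where "R = 1 + 1 / om + b * (u / (u - a))"
  have R: "1 \<le> R" "1 / om \<le> R" "b * (u / (u - a)) \<le> R"
    using om_pos b_ge_1 u_gt_a u_pos by (auto simp: R_def)
  have V1: "V 1 x \<le> R * V (-1) x" for x
  proof (cases "x \<le> z")
    case True
    then have "V 1 x = 1 / om * V (-1) x" using om_pos by (simp add: V_def)
    also have "\<dots> \<le> R * V (-1) x" using R(2) V_pos[of "-1" x] by (intro mult_right_mono) auto
    finally show ?thesis .
  next
    case False
    then have x: "z < x" by simp
    have "V 1 x \<le> b * exp x" using x a lam rho by (simp add: V_def)
    also have "\<dots> \<le> b * (u / (u - a) * (exp x - a))"
      using exp_le_shift[OF x] b_ge_1 by (intro mult_left_mono) auto
    also have "\<dots> = b * (u / (u - a)) * V (-1) x" using x by (simp add: V_def)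
    also have "\<dots> \<le> R * V (-1) x" using R(3) V_pos[of "-1" x] by (intro mult_right_mono) auto
    finally show ?thesis .
  qed
  have scale: "y \<le> R * y" if "0 < y" for y
    using R(1) that by (simp add: mult_le_cancel_right1)
  have ratio: "V (- i) x \<le> R * V i x" for i x
  proof -
    consider "i = 1" | "i = -1" | "i \<noteq> 1" "i \<noteq> -1" by blast
    then show ?thesis
    proof cases
      case 1
      then show ?thesis using V_mono_state[of x] scale[OF V_pos[of 1 x]] by simp
    next
      case 2
      then show ?thesis using V1[of x] by simp
    next
      case 3
      then have "- i \<noteq> 1" by (metis minus_minus)
      then have "V (- i) x = V i x" using 3 by (simp add: V_def)
      then show ?thesis using scale[OF V_pos[of i x]] by simp
    qed
  qed
  have "\<exists>K\<ge>0. \<forall>i x. x \<noteq> z \<longrightarrow> \<bar>V' i x\<bar> \<le> K * V i x"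
    using bound K(1) by blast
  moreover have "\<exists>R\<ge>0. \<forall>i x. V (- i) x \<le> R * V i x"
    using ratio R(1) by (intro exI[of _ R]) auto
  ultimately show ?thesis
    unfolding log_lipschitz_profile_def using V_cont V_pos V_deriv by simp
qed

text \<open>Equality holds on both sides of \<open>z\<close> because continuing is optimal in state
  +1 at every price.\<close>

lemma V_up: "p * V' 1 x = D * V 1 x - lam * V (-1) x"
proof (cases "x \<le> z")
  case True
  have "D * (C * exp (Om * x)) - lam * (C * om * exp (Om * x)) = (D - lam * om) * (C * exp (Om * x))"
    by (simp add: algebra_simps)
  also have "\<dots> = p * Om * (C * exp (Om * x))" by (simp add: lam_om)
  finally show ?thesis using True by (simp add: V_def V'_def)
next
  case False
  have "D * (a * (lam / D)) = lam * a" using lam rho by simp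
  then have "D * (b * exp x - a * (lam / D)) - lam * (exp x - a) = (D * b - lam) * exp x"
    by (simp add: algebra_simps)
  also have "D * b - lam = p * b" using b_mult by (simp add: algebra_simps)
  finally show ?thesis using False by (simp add: V_def V'_def)
qed

lemma V_down_eq: "(mu - sig) * V' (-1) x = D * V (-1) x - lam * V 1 x" if "x \<le> z"
proof -
  have "D * (C * om * exp (Om * x)) - lam * (C * exp (Om * x)) = (D * om - om * (D + q * Om)) * (C * exp (Om * x))"
    unfolding om_eq by (simp add: algebra_simps)
  then show ?thesis using that by (simp add: V_def V'_def algebra_simps)
qed

text \<open>Beyond \<open>z\<close> the right side minus the left is affine in \<open>exp x\<close>
  with positive slope by \<open>gap\<close>, so it is enough to look at \<open>z\<close>. There the
  left branch gives equality, and replacing its slope by the larger right slope, multiplied by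
  \<open>mu - sig < 0\<close>, only helps.\<close>

lemma V_down_le: "(mu - sig) * V' (-1) x \<le> D * V (-1) x - lam * V 1 x"
proof (cases "x \<le> z")
  case True
  then show ?thesis using V_down_eq by simp
next
  case False
  then have x: "z < x" by simp
  have coef: "0 < D + q - lam * b"
  proof -
    have "0 < ((D + q) * (D - p) - lam\<^sup>2) / (D - p)"
      using gap D_gt_p by (simp add: mult.commute)
    also have "\<dots> = D + q - lam * b" unfolding b_eq using D_gt_p by (simp add: field_simps power2_eq_square)
    finally show ?thesis .
  qed
  have "q * ((u - a) * Om) \<le> q * u" using kink mu_less_sig by (intro mult_left_mono) auto
  moreover have "(mu - sig) * (Om * (u - a)) = D * (u - a) - lam * (b * u - a * (lam / D))"
    using V_down_eq[of z] C_exp by (simp add: V_def V'_def mult.left_commute mult.assoc)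
  ultimately have at_u: "0 \<le> (D + q - lam * b) * u - a * (D - lam * (lam / D))"
    by (simp add: algebra_simps)
  have "(D + q - lam * b) * u \<le> (D + q - lam * b) * exp x"
    using coef exp_gt_u[OF x] by (intro mult_left_mono) auto
  with at_u have "0 \<le> (D + q - lam * b) * exp x - a * (D - lam * (lam / D))" by simp
  then show ?thesis using x by (simp add: V_def V'_def algebra_simps)
qed

text \<open>The excess over \<open>exp x\<close> decreases strictly up to \<open>z\<close>, where it
  equals \<open>- a\<close>: \<open>kink\<close> gives the sign of its derivative at
  \<open>z\<close>, and \<open>Om > 1\<close> keeps this sign to the left.\<close>

lemma V_down_gt: "exp x - a < V (-1) x" if "x < z"
proof -
  define \<phi> where "\<phi> t = C * om * exp (Om * t) - exp t" for t
  have "\<phi> z < \<phi> x"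
  proof (rule DERIV_neg_imp_decreasing[OF that])
    fix t assume t: "x \<le> t" "t \<le> z"
    have "(\<phi> has_real_derivative C * om * (Om * exp (Om * t)) - exp t) (at t)"
      unfolding \<phi>_def by (auto intro!: derivative_eq_intros)
    moreover have "C * om * (Om * exp (Om * t)) - exp t < 0"
    proof -
      have "C * om * (Om * exp (Om * t)) = (C * om * exp (Om * z)) * Om * exp (Om * (t - z))"
        by (simp add: algebra_simps flip: exp_add)
      also have "\<dots> = (u - a) * Om * exp (Om * (t - z))" by (simp only: C_exp)
      also have "\<dots> < u * exp (Om * (t - z))" using kink by simp
      also have "\<dots> \<le> u * exp (1 * (t - z))"
        using mult_right_mono_neg[of 1 Om "t - z"] t Om_gt_1 u_pos by (intro mult_left_mono) auto
      also have "\<dots> = exp t" using u_pos by (simp add: exp_diff)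
      finally show ?thesis by simp
    qed
    ultimately show "\<exists>y. (\<phi> has_real_derivative y) (at t) \<and> y < 0" by blast
  qed
  then show ?thesis using that C_exp exp_z by (simp add: \<phi>_def V_def)
qed

lemma V_down_ge: "exp x - a \<le> V (-1) x"
  using V_down_gt[of x] C_exp exp_z by (cases "x < z") (auto simp: V_def le_less)

lemma V_up_gt: "exp x - a < V 1 x"
proof (cases "x \<le> z")
  case True
  have "V (-1) x = om * V 1 x" using True by (simp add: V_def)
  also have "\<dots> < V 1 x" using om_less_1 V_pos[of 1 x] by simp
  finally show ?thesis using V_down_ge[of x] by simp
next
  case False
  have "a * (lam / D) < a * 1" using lam_D a by (intro mult_strict_left_mono) auto
  moreover have "1 * exp x \<le> b * exp x" using b_ge_1 by (intro mult_right_mono) auto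
  moreover have "V 1 x = b * exp x - a * (lam / D)" using False by (simp add: V_def)
  ultimately show ?thesis by linarith
qed

lemma V_ge: "exp x - a \<le> V i x"
  using V_up_gt[of x] V_down_ge[of x] by (cases "i = 1") (auto simp: V_def)

text \<open>Left of \<open>z\<close> the power \<open>Om > 1\<close> falls off faster than
  \<open>exp x\<close>, so the bound at \<open>z\<close> propagates. Linear growth in the price is
  what permits comparison with \<open>W\<close>.\<close>

lemma V_le: "V i x \<le> b * exp x"
proof -
  have "V 1 x \<le> b * exp x"
  proof (cases "x \<le> z")
    case True
    have "V 1 x = (C * exp (Om * z)) * exp (Om * (x - z))"
      using True by (simp add: V_def algebra_simps flip: exp_add)
    also have "\<dots> \<le> (b * u) * exp (1 * (x - z))"
      unfolding C_exp using mult_right_mono_neg[of 1 Om "x - z"] True Om_gt_1 a lam rho b_ge_1 u_pos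
      by (intro mult_mono) auto
    also have "\<dots> = b * exp x" using u_pos by (simp add: exp_diff)
    finally show ?thesis .
  next
    case False
    then show ?thesis using a lam rho by (simp add: V_def)
  qed
  moreover have "V i x = V 1 x \<or> V i x = V (-1) x" by (simp add: V_def)
  ultimately show ?thesis using V_mono_state[of x] by linarith
qed

text \<open>The positive eigenvector of the generator of \<open>e\<^sup>x\<close>: the expected price grows at the rate
  \<open>growth\<close>, and the first assumption on \<open>rho\<close> says \<open>growth < rho\<close>.\<close>

definition "growth = mu - lam + sqrt (sig\<^sup>2 + lam\<^sup>2)"

definition W :: "real \<Rightarrow> real \<Rightarrow> real" where
  "W i x = (if i = 1 then lam else sqrt (sig\<^sup>2 + lam\<^sup>2) - sig) * exp x"

lemma W_down_pos: "0 < sqrt (sig\<^sup>2 + lam\<^sup>2) - sig"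
proof -
  have "sqrt (sig\<^sup>2) < sqrt (sig\<^sup>2 + lam\<^sup>2)" using lam by (intro real_sqrt_less_mono) simp
  then show ?thesis using sig by simp
qed

lemma W_pos: "0 < W i x"
  using W_down_pos lam by (simp add: W_def)

lemma W_profile: "log_lipschitz_profile W W 0"
proof -
  let ?w = "sqrt (sig\<^sup>2 + lam\<^sup>2) - sig"
  define R where "R = 1 + ?w / lam + lam / ?w"
  have R: "1 \<le> R" "?w / lam \<le> R" "lam / ?w \<le> R"
    using W_down_pos lam by (auto simp: R_def)
  have coef: "(if - i = 1 then lam else ?w) \<le> R * (if i = 1 then lam else ?w)" for i :: real
  proof -
    have "?w = ?w / lam * lam" "lam = lam / ?w * ?w" using lam W_down_pos by simp_all
    then have "?w \<le> R * lam" "lam \<le> R * ?w"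
      using R(2,3) lam W_down_pos by (metis less_imp_le mult_right_mono)+
    moreover have "?w \<le> R * ?w"
      using R(1) W_down_pos by (simp add: mult_le_cancel_right1)
    ultimately show ?thesis by auto
  qed
  have ratio: "W (- i) x \<le> R * W i x" for i x
    using mult_right_mono[OF coef[of i], of "exp x"] by (simp add: W_def mult.assoc)
  have "(W i has_real_derivative W i x) (at x)" for i x
    unfolding W_def by (auto intro!: derivative_eq_intros)
  moreover have "continuous_on UNIV (W i)" for i
    unfolding W_def by (intro continuous_intros)
  moreover have "\<exists>K\<ge>0. \<forall>i x. x \<noteq> 0 \<longrightarrow> \<bar>W i x\<bar> \<le> K * W i x"
    using W_pos by (intro exI[of _ 1]) (simp add: less_imp_le)
  moreover have "\<exists>R\<ge>0. \<forall>i x. W (- i) x \<le> R * W i x"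
    using ratio R(1) by (intro exI[of _ R]) auto
  ultimately show ?thesis
    unfolding log_lipschitz_profile_def using W_pos by simp
qed

lemma W_up: "p * W 1 x = (lam + growth) * W 1 x - lam * W (-1) x"
  by (simp add: W_def growth_def algebra_simps)

lemma W_down: "(mu - sig) * W (-1) x = (lam + growth) * W (-1) x - lam * W 1 x"
proof -
  have "sqrt (sig\<^sup>2 + lam\<^sup>2) * sqrt (sig\<^sup>2 + lam\<^sup>2) = sig * sig + lam * lam"
    by (simp add: power2_eq_square flip: real_sqrt_mult)
  then have "(mu - sig) * (sqrt (sig\<^sup>2 + lam\<^sup>2) - sig)
      = (lam + growth) * (sqrt (sig\<^sup>2 + lam\<^sup>2) - sig) - lam * lam"
    by (simp add: growth_def algebra_simps)
  then have "(mu - sig) * (sqrt (sig\<^sup>2 + lam\<^sup>2) - sig) * exp x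
      = ((lam + growth) * (sqrt (sig\<^sup>2 + lam\<^sup>2) - sig) - lam * lam) * exp x" by simp
  then show ?thesis by (simp add: W_def algebra_simps)
qed

lemma V_le_W: "V i x \<le> b * (1 / lam + 1 / (sqrt (sig\<^sup>2 + lam\<^sup>2) - sig)) * W i x"
proof -
  let ?w = "sqrt (sig\<^sup>2 + lam\<^sup>2) - sig"
  have "1 \<le> (1 / lam + 1 / ?w) * (if i = 1 then lam else ?w)"
    using lam W_down_pos by (simp add: distrib_right)
  then have "b * exp x * 1 \<le> b * exp x * ((1 / lam + 1 / ?w) * (if i = 1 then lam else ?w))"
    using b_ge_1 by (intro mult_left_mono) auto
  also have "\<dots> = b * (1 / lam + 1 / ?w) * W i x"
    unfolding W_def by (simp only: ac_simps)
  finally show ?thesis using V_le[of i x] by simp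
qed

end


section \<open>The value function\<close>

lemma telegraph_exists:
  assumes chain: "markov_chain_from M {-1, 1} (flip_generator lam) \<xi> s"
    and "s \<in> {-1, 1}" "0 < lam" "0 < mu" "mu < sig"
  obtains p where "telegraph M \<xi> p lam mu sig s"
proof -
  note chain = chain[unfolded markov_chain_from_def]
  obtain p where p: "transition_semigroup {-1, 1} (flip_generator lam) p"
    "\<forall>t\<ge>0. \<forall>h\<ge>0. \<forall>j\<in>{-1, 1}. AE w in M. real_cond_exp M (natural_filtration M \<xi> (ennreal t))
             (indicat_real {v \<in> space M. \<xi> (t + h) v = j}) w = p h (\<xi> t w) j"
    using chain by blast
  have "telegraph_axioms M \<xi> p lam mu sig s"
  proof (rule telegraph_axioms.intro)
    show "AE w in M. \<xi> 0 w = s" using chain by simp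
    show "\<xi> t \<in> borel_measurable M" if "0 \<le> t" for t using chain that by simp
    show "\<xi> t w \<in> {-1, 1}" if "w \<in> space M" "0 \<le> t" for t w using chain that by simp
    show "step_path (\<lambda>t. \<xi> t w)" if "w \<in> space M" for w using chain that by simp
    show "AE w in M. real_cond_exp M (natural_filtration M \<xi> (ennreal t))
        (indicat_real {v \<in> space M. \<xi> (t + h) v = j}) w = p h (\<xi> t w) j"
      if "0 \<le> t" "0 \<le> h" "j \<in> {-1, 1}" for t h j using p(2) that by blast
  qed (fact p(1) assms(2-))+
  then show ?thesis using chain by (intro that telegraph.intro) auto
qed

context stopping_regime
begin

text \<open>\<open>V\<close> is positive and dominates the payoff, so it bounds even the expectation
  of the positive part of the reward; subtracting the negative part can only lower the
  value.\<close>

lemma expected_reward_le: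
  assumes "telegraph M \<xi> P lam mu sig s"
    and tau: "stopping_time (completed_natural_filtration M \<xi>) tau"
  shows "extended_expectation (completion M) (\<lambda>w. reward mu sig a rho \<xi> (exp x) (tau w) w) \<le> ereal (V s x)"
proof -
  interpret telegraph M \<xi> P lam mu sig s by fact
  let ?X = "\<lambda>w. reward mu sig a rho \<xi> (exp x) (tau w) w"
  have "(\<integral>\<^sup>+w. ennreal (?X w) \<partial>completion M)
    \<le> (\<integral>\<^sup>+w. (if tau w = \<infinity> then 0 else ennreal (exp (- rho * enn2real (tau w))
        * V (\<xi> (enn2real (tau w)) w) (log_price x (enn2real (tau w)) w))) \<partial>completion M)"
    using V_ge by (intro nn_integral_mono) (auto simp: reward_def price_eq_exp intro!: ennreal_leI)
  also have "\<dots> \<le> ennreal (V s x)"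
  proof (rule expected_profile_le[OF V_profile _ tau])
    fix i y :: real assume "i \<in> {-1, 1}"
    then show "speed i * V' i y \<le> (lam + rho) * V i y - lam * V (- i) y"
      using V_up[of y] V_down_le[of y] by (auto simp: speed_def)
  qed
  finally have "enn2ereal (\<integral>\<^sup>+w. ennreal (?X w) \<partial>completion M) \<le> enn2ereal (ennreal (V s x))"
    by (simp add: less_eq_ennreal.rep_eq)
  also have "\<dots> = ereal (V s x)" using V_pos by (simp add: enn2ereal_ennreal less_imp_le)
  finally show ?thesis
    unfolding extended_expectation_def
    using ereal_diff_le_mono_left enn2ereal_nonneg by blast
qed

lemma value_eq_V:
  assumes chain: "markov_chain_from (P s) {-1, 1} (flip_generator lam) \<xi> s"
    and s: "s \<in> {-1, 1}" and "0 < y"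
  shows "value_fun mu sig a rho P \<xi> y s = ereal (V s (ln y))"
proof -
  obtain p where tel: "telegraph (P s) \<xi> p lam mu sig s"
    using telegraph_exists[OF chain s lam mu mu_less_sig] .
  interpret telegraph "P s" \<xi> p lam mu sig s by (rule tel)
  have y: "y = exp (ln y)" using \<open>0 < y\<close> by simp
  show ?thesis
  proof (rule antisym)
    show "value_fun mu sig a rho P \<xi> y s \<le> ereal (V s (ln y))"
      unfolding value_fun_def using expected_reward_le[OF tel, of _ "ln y"] y
      by (intro SUP_least) auto
    show "ereal (V s (ln y)) \<le> value_fun mu sig a rho P \<xi> y s"
    proof (rule ereal_le_epsilon2)
      fix e :: real assume "0 < e"
      have "\<exists>tau. stopping_time (completed_natural_filtration (P s) \<xi>) tau \<and> ereal (V s (ln y) - e)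
        \<le> extended_expectation (completion (P s)) (\<lambda>w. reward mu sig a rho \<xi> (exp (ln y)) (tau w) w)"
      proof (rule stopping_value_ge[OF V_profile _ _ a W_profile _ _ V_le_W \<open>0 < e\<close>])
        fix i x :: real assume "i \<in> {-1, 1}"
        then show "speed i * W i x \<le> (lam + growth) * W i x - lam * W (- i) x"
          using W_up[of x] W_down[of x] by (auto simp: speed_def)
        assume "i = 1 \<or> x < ln u"
        with \<open>i \<in> {-1, 1}\<close> show "(lam + rho) * V i x - lam * V (- i) x \<le> speed i * V' i x"
          using V_up[of x] V_down_eq[of x] by (auto simp: speed_def)
      next
        fix x assume "ln u \<le> x"
        then show "V (-1) x = exp x - a"
          using C_exp exp_z by (auto simp: V_def le_less)
      next
        show "growth < rho" using rho_gt by (simp add: growth_def)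
      qed
      then obtain tau where tau: "stopping_time (completed_natural_filtration (P s) \<xi>) tau"
        "ereal (V s (ln y) - e) \<le> extended_expectation (completion (P s)) (\<lambda>w. reward mu sig a rho \<xi> y (tau w) w)"
        using y by auto
      have "ereal (V s (ln y) - e) \<le> value_fun mu sig a rho P \<xi> y s"
        unfolding value_fun_def by (rule SUP_upper2[where i=tau]) (use tau in auto)
      then show "ereal (V s (ln y)) \<le> value_fun mu sig a rho P \<xi> y s + ereal e"
        by (cases "value_fun mu sig a rho P \<xi> y s") auto
    qed
  qed
qed

text \<open>A zero price has no logarithm and is treated apart: the reward is never positive, and
  never stopping attains 0.\<close>

lemma value_at_0: "value_fun mu sig a rho P \<xi> 0 s = 0"
proof -
  have le: "extended_expectation M (\<lambda>w. reward mu sig a rho \<xi> 0 (tau w) w) \<le> 0" for M tau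
  proof -
    have "ennreal (reward mu sig a rho \<xi> 0 (tau w) w) = 0" for w
      using a by (simp add: reward_def price_def ennreal_neg mult_nonneg_nonpos)
    moreover have "0 - enn2ereal v \<le> 0" for v
      using enn2ereal_nonneg[of v] by (cases "enn2ereal v") (auto simp: zero_ereal_def)
    ultimately show ?thesis by (simp add: extended_expectation_def zero_ennreal.rep_eq)
  qed
  show ?thesis
  proof (rule antisym)
    show "value_fun mu sig a rho P \<xi> 0 s \<le> 0"
      unfolding value_fun_def using le by (intro SUP_least) auto
    have "extended_expectation (completion (P s)) (\<lambda>w. reward mu sig a rho \<xi> 0 \<infinity> w) = 0"
      by (simp add: reward_def extended_expectation_def)
    then show "0 \<le> value_fun mu sig a rho P \<xi> 0 s"
      unfolding value_fun_def by (intro SUP_upper2[of "\<lambda>_. \<infinity>"]) (auto simp: stopping_time_const)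
  qed
qed

end

theorem theorem10:
  fixes lam mu sig a rho :: real
    and P :: "real \<Rightarrow> 'a measure"
    and \<xi> :: "real \<Rightarrow> 'a \<Rightarrow> real"
  assumes pos: "lam > 0" "mu > 0" "sig > 0" "a > 0" "rho > 0"
    and chain: "\<And>s. s \<in> {-1, 1} \<Longrightarrow> markov_chain_from (P s) {-1, 1} (flip_generator lam) \<xi> s"
    and rho_gt: "rho > mu - lam + sqrt (sig\<^sup>2 + lam\<^sup>2)"
    and rho_le: "rho \<le> mu + sig"
    and mu_sig: "mu - sig < 0"
  defines "g \<equiv> value_fun mu sig a rho P \<xi>"
    and "b \<equiv> b_const lam mu sig rho"
    and "Om \<equiv> Omega_minus lam mu sig rho"
    and "om \<equiv> omega_minus lam mu sig rho"
  defines "u \<equiv> a * ((1 - lam / (lam + rho) * om) / (1 - b * om))"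
  defines "C \<equiv> (u - a) / (om * u powr Om)"
  shows "threshold a g 1 = \<infinity> \<and>
    threshold a g (-1) = ereal u \<and>
    (\<forall>y. 0 \<le> y \<and> y \<le> u \<longrightarrow> g y (-1) = ereal (C * om * y powr Om)) \<and>
    (\<forall>y\<ge>u. g y (-1) = ereal (y - a)) \<and>
    (\<forall>y. 0 \<le> y \<and> y \<le> u \<longrightarrow> g y 1 = ereal (C * y powr Om)) \<and>
    (\<forall>y\<ge>u. g y 1 = ereal (b * y - a * (lam / (lam + rho))))"
proof -
  interpret R: stopping_regime lam mu sig a rho
    using pos rho_gt rho_le mu_sig by unfold_locales auto
  have const_eqs: "R.b = b" "R.Om = Om" "R.om = om"
    by (simp_all add: R.b_def R.Om_def R.om_def b_def Om_def om_def)
  have u: "R.u = u" unfolding R.u_def u_def const_eqs ..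
  have C: "R.C = C" unfolding R.C_def C_def const_eqs u ..
  have u_pos: "0 < u" using R.u_pos by (simp add: u)
  have g0: "g 0 s = 0" for s unfolding g_def by (rule R.value_at_0)
  have g: "g y s = ereal (R.V s (ln y))" if "s \<in> {-1, 1}" "0 < y" for y s
    unfolding g_def by (rule R.value_eq_V[where P=P and s=s, OF chain]) (use that in auto)
  \<comment> \<open>At \<open>y = 0\<close> both sides vanish, since
    \<open>0 powr Om = 0\<close>.\<close>
  have low: "g y (-1) = ereal (C * om * y powr Om)" "g y 1 = ereal (C * y powr Om)"
    if "0 \<le> y" "y \<le> u" for y
    using that g[of _ y] g0 by (cases "y = 0"; simp add: R.V_def const_eqs C u powr_def zero_ereal_def)+
  have high: "g y (-1) = ereal (y - a)" "g y 1 = ereal (b * y - a * (lam / (lam + rho)))" if "u \<le> y" for y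
  proof -
    have y: "0 < y" using that u_pos by simp
    have "R.V (-1) (ln y) = y - a \<and> R.V 1 (ln y) = b * y - a * (lam / (lam + rho))"
    proof (cases "y = u")
      \<comment> \<open>At \<open>u\<close> itself \<open>R.V\<close> takes its left branch; the
        matching identities \<open>R.C_exp\<close> turn it into the right one.\<close>
      case True
      then show ?thesis
        using R.C_exp R.exp_z by (simp add: R.V_def const_eqs C u)
    next
      case False
      then show ?thesis using that y u_pos by (simp add: R.V_def const_eqs u)
    qed
    then show "g y (-1) = ereal (y - a)" "g y 1 = ereal (b * y - a * (lam / (lam + rho)))"
      using g[OF _ y] by simp_all
  qed
  have "stopping_region a g 1 = {}"
  proof -
    have "g y 1 \<noteq> ereal (y - a)" if "0 \<le> y" for y
    proof (cases "y = 0")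
      case True
      then show ?thesis using g0 pos by (simp add: zero_ereal_def)
    next
      case False
      then show ?thesis using that g[of 1 y] R.V_up_gt[of "ln y"] by simp
    qed
    then show ?thesis by (auto simp: stopping_region_def)
  qed
  moreover have "stopping_region a g (-1) = {y. ereal u \<le> ereal y}"
  proof -
    have "g y (-1) \<noteq> ereal (y - a)" if "0 \<le> y" "y < u" for y
    proof (cases "y = 0")
      case True
      then show ?thesis using g0 pos by (simp add: zero_ereal_def)
    next
      case False
      then have "0 < y" "ln y < ln R.u" using that by (simp_all add: u)
      then show ?thesis using g[of "-1" y] R.V_down_gt[of "ln y"] by simp
    qed
    then show ?thesis
      using high(1) u_pos by (force simp: stopping_region_def)
  qed
  ultimately show ?thesis
    using low high u_pos threshold_eqI[of "ereal u" a g "-1"]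
    by (simp add: threshold_eq_infinity_iff)
qed

end
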